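(* Let $p,q$ be positive integers with $p+q=2n$, let $r=\min(p,q)$, and let $\epsilon\in\{0,1\}$ be the parity of $p$ ($\epsilon=0$ if $p$ is even, $\epsilon=1$ if $p$ is odd). Let $X\in\mathfrak{o}_{2n}$ be written in block form $$X=\begin{bmatrix} a&b\\ c&-J_q\,{}^ta\,J_p\end{bmatrix}$$ with $a,b,c$ of size $p\times q$, $p\times p$, $q\times q$ respectively, and set $a_{i,j}=X_{i,j}$ for $i\in[p],j\in[q]$, $b_{i,j}=X_{i,-j}$ for $i,j\in[p]$, and $c_{i,j}=X_{-j,i}$ for $i,j\in[q]$, where $-i$ stands for the index $2n+1-i$. Then $$\operatorname{Pf}(X)=\sum_{k=0}^{\lfloor r/2\rfloor}\ \sum_{\substack{I\subset[p],\,J\subset[q]\\ |\bar I|=|\bar J|=2k+\epsilon}}\operatorname{sgn}(\bar I,I)\,\operatorname{sgn}(\bar J,J)\,\det(a^{\bar I}_{\bar J})\,\operatorname{Pf}(b_I)\,\operatorname{Pf}(c_J),$$ where $\bar I$ is the complement of $I$ in $[p]$ and $\bar J$ is the complement of $J$ in $[q]$.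
   Context: Notation. $[m]=\{1,\dots,m\}$. Row and column indices of $2n\times2n$ matrices lie in $[2n]$, and $-i$ stands for $2n+1-i$. $J_N$ is the $N\times N$ matrix with $1$'s on the anti-diagonal and $0$'s elsewhere; $\mathfrak{o}_{2n}=\{X\in\mathrm{Mat}_{2n}(\mathbb{C}):{}^tXJ_{2n}+J_{2n}X=0\}$. For $X\in\mathfrak o_{2n}$ the matrix $XJ_{2n}$, with $(i,j)$ entry $X_{i,-j}$, is alternating, and $\operatorname{Pf}(X)$ means the (usual) Pfaffian of $XJ_{2n}$. The arrays $b_{i,j}$ and $c_{i,j}$ satisfy $b_{j,i}=-b_{i,j}$, $c_{j,i}=-c_{i,j}$. For $I=\{i_1<\dots<i_{2m}\}\subset[p]$, $\operatorname{Pf}(b_I)$ is the usual Pfaffian of the alternating matrix $(b_{i_s,i_t})_{s,t\in[2m]}$, and similarly $\operatorname{Pf}(c_J)$ is that of $(c_{j_s,j_t})_{s,t}$ for $J\subset[q]$. $a^{\bar I}_{\bar J}=(a_{i,j})_{i\in\bar I,j\in\bar J}$ with rows and columns in increasing order. Empty Pfaffians and determinants equal $1$. The Pfaffian of an alternating complex $2m\times2m$ matrix $A$ is $\operatorname{Pf}(A)=\frac{1}{2^m m!}\sum_{\sigma\in\mathfrak S_{2m}}\operatorname{sgn}(\sigma)A_{\sigma(1),\sigma(2)}\cdots A_{\sigma(2m-1),\sigma(2m)}$. Signs: if $[p]=\bar I\sqcup I$, $\bar I=\{\bar i_1<\dots<\bar i_h\}$, $I=\{i_1<\dots<i_s\}$,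 then $\operatorname{sgn}(\bar I,I)$ is the signature of the permutation sending $1,\dots,p$ to $\bar i_1,\dots,\bar i_h,i_1,\dots,i_s$; $\operatorname{sgn}(\bar J,J)$ is defined likewise with $[q]$. *)

theory Defs
  imports
    "HOL-Combinatorics.Permutations"
    "Jordan_Normal_Form.Determinant"
    "Jordan_Normal_Form.DL_Submatrix"
begin

text \<open>
  Matrix indices are 0-based: the index \<open>i \<in> [N]\<close> of the mathematical text is represented
  by \<open>i - 1 \<in> {..<N}\<close>.
\<close>

definition neg_idx :: "nat \<Rightarrow> nat \<Rightarrow> nat" where
  \<comment> \<open>the index \<open>-i = 2n + 1 - i\<close>; after the shift to 0-based indices, \<open>i \<mapsto> 2n - 1 - i\<close>\<close>
  "neg_idx n i = 2 * n - 1 - i"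

definition antidiag_mat :: "nat \<Rightarrow> complex mat" where
  "antidiag_mat N = mat N N (\<lambda>(i, j). if i + j + 1 = N then 1 else 0)"

definition orth_lie :: "nat \<Rightarrow> complex mat set" where
  "orth_lie N = {X \<in> carrier_mat N N.
     transpose_mat X * antidiag_mat N + antidiag_mat N * X = 0\<^sub>m N N}"

text \<open>Only meaningful for alternating matrices of even size \<open>2m\<close>.\<close>

definition pfaffian :: "complex mat \<Rightarrow> complex" where
  "pfaffian A = (let m = dim_row A div 2 in
     1 / (2 ^ m * fact m) *
     (\<Sum>\<sigma> | \<sigma> permutes {..<2 * m}.
        of_int (sign \<sigma>) * (\<Prod>i<m. A $$ (\<sigma> (2 * i), \<sigma> (2 * i + 1)))))"

definition Pf_orth :: "complex mat \<Rightarrow> complex" where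
  "Pf_orth X = pfaffian (X * antidiag_mat (dim_col X))"

definition sgn_split :: "nat \<Rightarrow> nat set \<Rightarrow> nat set \<Rightarrow> complex" where
  \<comment> \<open>for \<open>{..<m} = K \<squnion> L\<close>\<close>
  "sgn_split m K L = of_int (sign (\<lambda>i. if i < m
     then (sorted_list_of_set K @ sorted_list_of_set L) ! i else i))"

lemma mat_mult_index:
  fixes A B :: "complex mat"
  assumes "A \<in> carrier_mat r s" "B \<in> carrier_mat s t" "i < r" "j < t"
  shows "(A * B) $$ (i, j) = (\<Sum>l = 0..<s. A $$ (i, l) * B $$ (l, j))"
  using assms by (auto simp: scalar_prod_def intro!: sum.cong)

lemma antidiag_mat_dim [simp]:
  "dim_row (antidiag_mat N) = N" "dim_col (antidiag_mat N) = N"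
  by (simp_all add: antidiag_mat_def)

lemma orth_lie_antisym:
  assumes X: "X \<in> orth_lie N" and i: "i < N" and j: "j < N"
  shows "X $$ (i, j) = - X $$ (N - 1 - j, N - 1 - i)"
proof -
  have Xc: "X \<in> carrier_mat N N"
    and eq: "transpose_mat X * antidiag_mat N + antidiag_mat N * X = 0\<^sub>m N N"
    using X by (auto simp: orth_lie_def)
  define k where "k = N - 1 - i"
  have k: "k < N" using i by (auto simp: k_def)
  have s1: "(transpose_mat X * antidiag_mat N) $$ (j, k) = X $$ (i, j)"
  proof -
    have "(transpose_mat X * antidiag_mat N) $$ (j, k)
        = (\<Sum>l = 0..<N. X $$ (l, j) * (if l + k + 1 = N then 1 else 0))"
      using Xc j k by (auto simp: scalar_prod_def antidiag_mat_def intro!: sum.cong)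
    also have "\<dots> = (\<Sum>l = 0..<N. if l = i then X $$ (l, j) else 0)"
      using i by (intro sum.cong) (auto simp: k_def)
    finally show ?thesis using i by simp
  qed
  have s2: "(antidiag_mat N * X) $$ (j, k) = X $$ (N - 1 - j, k)"
  proof -
    have "(antidiag_mat N * X) $$ (j, k)
        = (\<Sum>l = 0..<N. (if j + l + 1 = N then 1 else 0) * X $$ (l, k))"
      using Xc j k by (auto simp: scalar_prod_def antidiag_mat_def intro!: sum.cong)
    also have "\<dots> = (\<Sum>l = 0..<N. if l = N - 1 - j then X $$ (l, k) else 0)"
      using j by (intro sum.cong) auto
    finally show ?thesis using j by simp
  qed
  have "(transpose_mat X * antidiag_mat N + antidiag_mat N * X) $$ (j, k) = 0"
    using eq j k by simp
  moreover have "(transpose_mat X * antidiag_mat N + antidiag_mat N * X) $$ (j, k)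
      = (transpose_mat X * antidiag_mat N) $$ (j, k) + (antidiag_mat N * X) $$ (j, k)"
    using Xc j k by (subst index_add_mat) (auto simp: antidiag_mat_def)
  ultimately have "X $$ (i, j) + X $$ (N - 1 - j, k) = 0"
    using s1 s2 by simp
  then show ?thesis by (simp add: k_def eq_neg_iff_add_eq_0)
qed

lemma antidiag_conj_index:
  assumes a: "a \<in> carrier_mat p q" and i: "i < q" and j: "j < p"
  shows "(antidiag_mat q * transpose_mat a * antidiag_mat p) $$ (i, j)
    = a $$ (p - 1 - j, q - 1 - i)"
proof -
  have 1: "(antidiag_mat q * transpose_mat a) $$ (i, l) = a $$ (l, q - 1 - i)" if l: "l < p" for l
  proof -
    have "(antidiag_mat q * transpose_mat a) $$ (i, l)
        = (\<Sum>m = 0..<q. (if i + m + 1 = q then 1 else 0) * a $$ (l, m))"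
      using a i l by (auto simp: scalar_prod_def antidiag_mat_def intro!: sum.cong)
    also have "\<dots> = (\<Sum>m = 0..<q. if m = q - 1 - i then a $$ (l, m) else 0)"
      using i by (intro sum.cong) auto
    finally show ?thesis using i by simp
  qed
  have "(antidiag_mat q * transpose_mat a * antidiag_mat p) $$ (i, j)
      = (\<Sum>l = 0..<p. (antidiag_mat q * transpose_mat a) $$ (i, l) * antidiag_mat p $$ (l, j))"
    by (rule mat_mult_index) (use a i j in \<open>auto simp: antidiag_mat_def\<close>)
  also have "\<dots> = (\<Sum>l = 0..<p. a $$ (l, q - 1 - i) * (if l + j + 1 = p then 1 else 0))"
    using j by (intro sum.cong refl arg_cong2[of _ _ _ _ "(*)"] 1) (auto simp: antidiag_mat_def)
  also have "\<dots> = (\<Sum>l = 0..<p. if l = p - 1 - j then a $$ (l, q - 1 - i) else 0)"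
    using j by (intro sum.cong) auto
  finally show ?thesis using j by simp
qed

text \<open>
  The block form is no restriction: every element of \<open>orth_lie (p + q)\<close> has it. The blocks
  \<open>B\<close> and \<open>C\<close> differ from the alternating arrays \<open>b\<close> and \<open>c\<close> by a reversal of columns,
  respectively by a reversal of rows and a transposition.
\<close>

lemma orth_lie_block_form:
  assumes X: "X \<in> orth_lie (p + q)"
  shows "\<exists>a B C. a \<in> carrier_mat p q \<and> B \<in> carrier_mat p p \<and> C \<in> carrier_mat q q \<and>
    X = four_block_mat a B C (- (antidiag_mat q * transpose_mat a * antidiag_mat p))"
proof -
  have Xc: "X \<in> carrier_mat (p + q) (p + q)" using X by (auto simp: orth_lie_def)
  define a where "a = mat p q (\<lambda>(i, j). X $$ (i, j))"
  define B where "B = mat p p (\<lambda>(i, j). X $$ (i, q + j))"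
  define C where "C = mat q q (\<lambda>(i, j). X $$ (p + i, j))"
  let ?D = "antidiag_mat q * transpose_mat a * antidiag_mat p"
  have a: "a \<in> carrier_mat p q" by (simp add: a_def)
  have D: "?D \<in> carrier_mat q p"
    by (intro carrier_matI) (simp_all add: antidiag_mat_def)
  have "X = four_block_mat a B C (- ?D)"
  proof (rule eq_matI)
    fix i j
    assume "i < dim_row (four_block_mat a B C (- ?D))" "j < dim_col (four_block_mat a B C (- ?D))"
    then have ij: "i < p + q" "j < q + p" using D a by auto
    have lower: "X $$ (i, j) = - ?D $$ (i - p, j - q)" if "\<not> i < p" "\<not> j < q"
    proof -
      have "i - p < q" "j - q < p" using ij that by auto
      then have "?D $$ (i - p, j - q) = a $$ (p - 1 - (j - q), q - 1 - (i - p))"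
        by (rule antidiag_conj_index[OF a])
      also have "\<dots> = X $$ (p + q - 1 - j, p + q - 1 - i)"
        using ij that by (simp add: a_def) (intro arg_cong2[of _ _ _ _ "\<lambda>u v. X $$ (u, v)"]; simp)
      finally show ?thesis
        using orth_lie_antisym[OF X, of i j] ij by simp
    qed
    show "X $$ (i, j) = four_block_mat a B C (- ?D) $$ (i, j)"
      using ij D a lower by (cases "i < p"; cases "j < q") (simp_all add: a_def B_def C_def)
  qed (use Xc a D in auto)
  then show ?thesis
    using a by (intro exI[of _ a] exI[of _ B] exI[of _ C]) (simp add: B_def C_def)
qed

end

theory Submission
  imports Defs "HOL-Combinatorics.Multiset_Permutations"
begin

text \<open>
  Write \<open>A = X J\<close> for the antidiagonal matrix \<open>J\<close> and \<open>f j = - j\<close>. The index set of \<open>A\<close> is the disjoint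
  union of \<open>[p]\<close> and \<open>f [q]\<close>, and \<open>f\<close> reverses the order. On these pieces the entries of \<open>A\<close> are
  \<open>A i i' = b i i'\<close>, \<open>A i (f j) = a i j = - A (f j) i\<close> and \<open>A (f j) (f j') = - c j j'\<close>.

  The proof works with the Pfaffian \<open>pf_on A S\<close> of the part of an array \<open>A\<close> indexed by a finite set \<open>S\<close>
  of numbers. The tool for all that follows is the recursion
  \<open>|S| * pf_on A S = \<Sum> \<plusminus> A i j * pf_on A (S - {i, j})\<close>, where the sum is over all \<open>i \<noteq> j\<close> in \<open>S\<close>:
  the expansion along a row, added up over all rows (lemma \<open>pf_on_recursion\<close>). It is read off
  from the sum over permutations by splitting off the first two letters of each word and,
  unlike the expansion along a single row, it does not require \<open>A\<close> to be alternating. Together with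
  \<open>pf_on A {} = 1\<close> it determines all the values, so each of the following is proved by induction.

  \<^item> The Pfaffian of a sum \<open>A + B\<close> over \<open>S\<close> is the sum over \<open>T \<subseteq> S\<close> of
    \<open>sgn(T, S - T) * pf_on A T * pf_on B (S - T)\<close> (lemma \<open>pf_on_add\<close>).
  \<^item> If the nonzero entries of \<open>A\<close> all pair \<open>K \<subseteq> [p]\<close> with \<open>f L\<close>, where \<open>L \<subseteq> [q]\<close>, then
    \<open>pf_on A (K \<union> f L)\<close> is the minor of \<open>a\<close> with rows \<open>K\<close> and columns \<open>L\<close> if \<open>|K| = |L|\<close>, and \<open>0\<close>
    otherwise (lemma \<open>pf_on_bipartite\<close>). Because \<open>f\<close> reverses the order, no sign is left over.
  \<^item> Pulling back along \<open>f\<close> turns the array \<open>- c\<close> on \<open>f J\<close> into \<open>c\<close> on \<open>J\<close>, without a sign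
    (lemma \<open>pf_on_antimono\<close>).

  Splitting \<open>A\<close> into its mixed part and the sum of its two diagonal parts and applying these facts
  gives a sum over all \<open>I \<subseteq> [p]\<close> and \<open>J \<subseteq> [q]\<close> (lemma \<open>pf_on_block_expansion\<close>). A term can
  be nonzero only if the complements of \<open>I\<close> and \<open>J\<close> have the same size and \<open>|I|\<close> is even; then \<open>|J|\<close> is
  even too, because \<open>p + q\<close> is, and the sign of the term is the product of the two signs in the formula
  (lemma \<open>shuffle_sgn_blocks\<close>). Sorting these terms by the size of the complements gives the formula.
\<close>

section \<open>Inversion signs\<close>

text \<open>
  The sign contributed by a pair of letters \<open>i\<close>, \<open>x\<close> of which \<open>i\<close> is written first. All signs below
  take values in the complex numbers, so that they can be multiplied with entries directly.
\<close>

definition inv_sgn :: "nat \<Rightarrow> nat \<Rightarrow> complex" where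
  "inv_sgn i x = (if x < i then -1 else 1)"

text \<open>
  For finite \<open>S\<close>, the sign \<open>(-1) ^ card {x \<in> S. x < i}\<close> of moving the letter \<open>i\<close> from the front of the
  sorted word of \<open>S\<close> to its place. It does not matter whether \<open>i\<close> belongs to \<open>S\<close>.
\<close>

definition pos_sgn :: "nat set \<Rightarrow> nat \<Rightarrow> complex" where
  "pos_sgn S i = (\<Prod>x\<in>S. inv_sgn i x)"

text \<open>
  For disjoint finite \<open>K\<close> and \<open>L\<close>, the signature of the word that lists \<open>K\<close> in increasing order and
  then \<open>L\<close> in increasing order.
\<close>

definition shuffle_sgn :: "nat set \<Rightarrow> nat set \<Rightarrow> complex" where
  "shuffle_sgn K L = (\<Prod>k\<in>K. pos_sgn L k)"

text \<open>
  For distinct \<open>i\<close> and \<open>j\<close> in \<open>S\<close>, the signature of the word that lists \<open>i\<close>, then \<open>j\<close>, and then the rest of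
  \<open>S\<close> in increasing order. It is the coefficient that goes with the entry \<open>A i j\<close> in the expansion of a
  Pfaffian.
\<close>

definition pair_sgn :: "nat set \<Rightarrow> nat \<Rightarrow> nat \<Rightarrow> complex" where
  "pair_sgn S i j = pos_sgn S i * pos_sgn (S - {i}) j"

text \<open>
  The signature of a word with distinct letters, that is, \<open>-1\<close> to the number of its inversions.
\<close>

fun list_sgn :: "nat list \<Rightarrow> complex" where
  "list_sgn [] = 1"
| "list_sgn (x # xs) = pos_sgn (set xs) x * list_sgn xs"

lemma inv_sgn_same [simp]: "inv_sgn i i = 1"
  by (simp add: inv_sgn_def)

lemma inv_sgn_flip: "i \<noteq> x \<Longrightarrow> inv_sgn x i = - inv_sgn i x"
  by (auto simp: inv_sgn_def)

lemma pos_sgn_insert: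
  "finite S \<Longrightarrow> x \<notin> S \<Longrightarrow> pos_sgn (insert x S) i = inv_sgn i x * pos_sgn S i"
  by (simp add: pos_sgn_def)

lemma pos_sgn_card:
  assumes "finite S"
  shows "pos_sgn S i = (-1) ^ card {x \<in> S. x < i}"
proof -
  have "pos_sgn S i = (\<Prod>x\<in>{x \<in> S. x < i}. -1)"
    unfolding pos_sgn_def inv_sgn_def using assms by (simp only: prod.inter_filter)
  then show ?thesis by simp
qed

lemma pos_sgn_Un:
  "finite S \<Longrightarrow> finite T \<Longrightarrow> S \<inter> T = {} \<Longrightarrow> pos_sgn (S \<union> T) i = pos_sgn S i * pos_sgn T i"
  by (simp add: pos_sgn_def prod.union_disjoint)

lemma pos_sgn_Diff_self [simp]: "pos_sgn (S - {i}) i = pos_sgn S i"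
proof (cases "finite S \<and> i \<in> S")
  case True
  then show ?thesis
    by (simp add: pos_sgn_def prod.remove[of S i])
next
  case False
  then show ?thesis by (auto simp: pos_sgn_def)
qed

lemma pos_sgn_below: "(\<And>x. x \<in> S \<Longrightarrow> i \<le> x) \<Longrightarrow> pos_sgn S i = 1"
  by (auto simp: pos_sgn_def inv_sgn_def not_less intro!: prod.neutral)

lemma pos_sgn_above: "(\<And>x. x \<in> S \<Longrightarrow> x < i) \<Longrightarrow> pos_sgn S i = (-1) ^ card S"
  by (simp add: pos_sgn_def inv_sgn_def)

lemma prod_inv_sgn_flip:
  assumes "i \<notin> S"
  shows "(\<Prod>x\<in>S. inv_sgn x i) = (-1) ^ card S * pos_sgn S i"
proof -
  have "(\<Prod>x\<in>S. inv_sgn x i) = (\<Prod>x\<in>S. - 1 * inv_sgn i x)"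
    using assms by (intro prod.cong) (auto intro!: inv_sgn_flip)
  then show ?thesis by (simp only: prod.distrib pos_sgn_def prod_constant)
qed

lemma pair_sgn_swap:
  assumes "finite S" "i \<in> S" "j \<in> S" "i \<noteq> j"
  shows "pair_sgn S j i = - pair_sgn S i j"
proof -
  define T where "T = S - {i, j}"
  have "S - {i} = insert j T" "S - {j} = insert i T" "S = insert i (insert j T)"
    "finite T" "i \<notin> T" "j \<notin> T"
    using assms by (auto simp: T_def)
  then show ?thesis
    using assms by (simp add: pair_sgn_def pos_sgn_insert inv_sgn_flip[of i j])
qed

lemma shuffle_sgn_Un_left:
  "finite K \<Longrightarrow> finite K' \<Longrightarrow> K \<inter> K' = {} \<Longrightarrow>
    shuffle_sgn (K \<union> K') L = shuffle_sgn K L * shuffle_sgn K' L"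
  by (simp add: shuffle_sgn_def prod.union_disjoint)

lemma shuffle_sgn_Un_right:
  "finite L \<Longrightarrow> finite L' \<Longrightarrow> L \<inter> L' = {} \<Longrightarrow>
    shuffle_sgn K (L \<union> L') = shuffle_sgn K L * shuffle_sgn K L'"
  by (simp add: shuffle_sgn_def pos_sgn_Un prod.distrib)

lemma shuffle_sgn_below:
  assumes "\<And>k l. k \<in> K \<Longrightarrow> l \<in> L \<Longrightarrow> k \<le> l"
  shows "shuffle_sgn K L = 1"
  using assms by (auto simp: shuffle_sgn_def pos_sgn_below intro!: prod.neutral)

lemma shuffle_sgn_above:
  assumes "\<And>k l. k \<in> K \<Longrightarrow> l \<in> L \<Longrightarrow> l < k"
  shows "shuffle_sgn K L = (-1) ^ (card L * card K)"
  using assms by (simp add: shuffle_sgn_def pos_sgn_above power_mult)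

lemma shuffle_sgn_insert_left:
  assumes "finite T" "i \<notin> T" "j \<notin> T" "i \<noteq> j"
  shows "shuffle_sgn (insert i (insert j T)) U = pos_sgn U i * pos_sgn U j * shuffle_sgn T U"
  using assms by (simp add: shuffle_sgn_def mult.assoc)

lemma shuffle_sgn_insert_right:
  assumes "finite U" "i \<notin> U" "j \<notin> U" "i \<noteq> j" "i \<notin> T" "j \<notin> T"
  shows "shuffle_sgn T (insert i (insert j U)) = pos_sgn T i * pos_sgn T j * shuffle_sgn T U"
proof -
  have "shuffle_sgn T (insert i (insert j U))
      = (\<Prod>t\<in>T. inv_sgn t i) * (\<Prod>t\<in>T. inv_sgn t j) * shuffle_sgn T U"
    using assms by (simp add: shuffle_sgn_def pos_sgn_insert prod.distrib mult.assoc)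
  also have "\<dots> = pos_sgn T i * pos_sgn T j * shuffle_sgn T U * ((-1) ^ card T * (-1) ^ card T)"
    using assms by (simp add: prod_inv_sgn_flip)
  finally show ?thesis by (simp add: power_mult_distrib[symmetric])
qed

text \<open>
  This lemma and the next are the sign identities behind the Pfaffian of a sum: moving the pair
  \<open>i\<close>, \<open>j\<close> to the front of the word of \<open>S\<close> and then sorting out \<open>T\<close> from \<open>U\<close> costs the same as sorting out
  the part that contains the pair and moving the pair to the front within that part. For the pair in
  the right-hand part this holds whatever the parity of \<open>T\<close>, since two letters pass over \<open>T\<close>.
\<close>

lemma pair_sgn_shuffle_left:
  assumes "finite T" "finite U" "T \<inter> U = {}" "i \<notin> T" "j \<notin> T" "i \<notin> U" "j \<notin> U" "i \<noteq> j"
  shows "pair_sgn (insert i (insert j (T \<union> U))) i j * shuffle_sgn T U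
    = shuffle_sgn (insert i (insert j T)) U * pair_sgn (insert i (insert j T)) i j"
proof -
  have "insert i (insert j (T \<union> U)) - {i} = insert j (T \<union> U)"
    "insert i (insert j T) - {i} = insert j T"
    using assms by auto
  then show ?thesis
    using assms by (simp add: pair_sgn_def pos_sgn_insert pos_sgn_Un shuffle_sgn_insert_left)
qed

lemma pair_sgn_shuffle_right:
  assumes "finite T" "finite U" "T \<inter> U = {}" "i \<notin> T" "j \<notin> T" "i \<notin> U" "j \<notin> U" "i \<noteq> j"
  shows "pair_sgn (insert i (insert j (T \<union> U))) i j * shuffle_sgn T U
    = shuffle_sgn T (insert i (insert j U)) * pair_sgn (insert i (insert j U)) i j"
proof -
  have "insert i (insert j (T \<union> U)) - {i} = insert j (T \<union> U)"
    "insert i (insert j U) - {i} = insert j U"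
    using assms by auto
  then show ?thesis
    using assms by (simp add: pair_sgn_def pos_sgn_insert pos_sgn_Un shuffle_sgn_insert_right)
qed

lemma pos_sgn_strict_mono:
  assumes "strict_mono_on S f" "i \<in> S" "T \<subseteq> S"
  shows "pos_sgn (f ` T) (f i) = pos_sgn T i"
proof -
  have inj: "inj_on f T"
    using assms by (meson inj_on_subset strict_mono_on_imp_inj_on)
  have "inv_sgn (f i) (f x) = inv_sgn i x" if "x \<in> T" for x
    using strict_mono_on_less[OF assms(1)] that assms by (auto simp: inv_sgn_def)
  then show ?thesis by (simp add: pos_sgn_def prod.reindex[OF inj])
qed

lemma pos_sgn_antimono:
  assumes anti: "strict_antimono_on S f"
    and "finite S" "i \<in> S"
  shows "pos_sgn (f ` S) (f i) = (-1) ^ (card S - 1) * pos_sgn S i"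
proof -
  have inj: "inj_on f S"
    using anti by (simp add: strict_antimono_iff_antimono)
  have "inv_sgn (f i) (f x) = - inv_sgn i x" if "x \<in> S" "x \<noteq> i" for x
    using monotone_onD[OF anti, of i x] monotone_onD[OF anti, of x i] that \<open>i \<in> S\<close>
    by (cases x i rule: linorder_cases) (auto simp: inv_sgn_def)
  then have "pos_sgn (f ` S) (f i) = (\<Prod>x\<in>S-{i}. - 1 * inv_sgn i x)"
    using assms by (simp add: pos_sgn_def prod.reindex[OF inj] prod.remove[of S i])
  also have "\<dots> = (-1) ^ card (S - {i}) * pos_sgn (S - {i}) i"
    by (simp only: prod.distrib pos_sgn_def prod_constant)
  finally show ?thesis using assms by simp
qed

lemma shuffle_sgn_antimono:
  assumes anti: "strict_antimono_on (K \<union> L) f"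
    and "finite K" "finite L" "K \<inter> L = {}"
  shows "shuffle_sgn (f ` K) (f ` L) = (-1) ^ (card L * card K) * shuffle_sgn K L"
proof -
  have inj: "inj_on f (K \<union> L)"
    using anti by (simp add: strict_antimono_iff_antimono)
  then have inj': "inj_on f K" "inj_on f L"
    by (auto intro: inj_on_subset)
  have *: "inv_sgn (f k) (f l) = - 1 * inv_sgn k l" if "k \<in> K" "l \<in> L" for k l
    using monotone_onD[OF anti, of k l] monotone_onD[OF anti, of l k] that \<open>K \<inter> L = {}\<close>
    by (cases k l rule: linorder_cases) (auto simp: inv_sgn_def)
  have "shuffle_sgn (f ` K) (f ` L) = (\<Prod>k\<in>K. \<Prod>l\<in>L. inv_sgn (f k) (f l))"
    by (simp add: shuffle_sgn_def pos_sgn_def prod.reindex[OF inj'(1)] prod.reindex[OF inj'(2)])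
  also have "\<dots> = (\<Prod>k\<in>K. \<Prod>l\<in>L. - 1 * inv_sgn k l)"
    by (intro prod.cong refl *)
  finally show ?thesis
    by (simp only: prod.distrib pos_sgn_def shuffle_sgn_def prod_constant power_mult)
qed

lemma pair_sgn_strict_mono:
  assumes "strict_mono_on S f" "i \<in> S" "j \<in> S"
  shows "pair_sgn (f ` S) (f i) (f j) = pair_sgn S i j"
proof -
  have "f ` S - {f i} = f ` (S - {i})"
    using strict_mono_on_imp_inj_on[OF assms(1)] assms by (auto simp: inj_on_def)
  then show ?thesis
    using pos_sgn_strict_mono[OF assms(1)] assms by (simp add: pair_sgn_def)
qed

text \<open>
  Reversing the order flips each of the \<open>2 |S| - 3\<close> comparisons that involve \<open>i\<close> or \<open>j\<close>, an odd number.
\<close>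

lemma pair_sgn_antimono:
  assumes anti: "strict_antimono_on S f"
    and "finite S" "i \<in> S" "j \<in> S" "i \<noteq> j"
  shows "pair_sgn (f ` S) (f i) (f j) = - pair_sgn S i j"
proof -
  have inj: "inj_on f S"
    using anti by (simp add: strict_antimono_iff_antimono)
  have *: "f ` S - {f i} = f ` (S - {i})"
    using inj \<open>i \<in> S\<close> by (auto simp: inj_on_def)
  have "card {i, j} \<le> card S"
    using \<open>finite S\<close> \<open>i \<in> S\<close> \<open>j \<in> S\<close> by (intro card_mono) auto
  then have "card S \<ge> 2"
    using \<open>i \<noteq> j\<close> by simp
  then obtain h where h: "card S = 2 + h"
    by (rule less_eqE)
  have "pos_sgn (f ` S) (f i) = (-1) ^ (card S - 1) * pos_sgn S i"
    by (rule pos_sgn_antimono[OF anti \<open>finite S\<close> \<open>i \<in> S\<close>])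
  moreover have "pos_sgn (f ` (S - {i})) (f j) = (-1) ^ (card (S - {i}) - 1) * pos_sgn (S - {i}) j"
    using \<open>finite S\<close> \<open>j \<in> S\<close> \<open>i \<noteq> j\<close> 
    by (intro pos_sgn_antimono monotone_on_subset[OF anti]) auto
  ultimately show ?thesis
    using h \<open>finite S\<close> \<open>i \<in> S\<close> by (simp add: pair_sgn_def * power_mult_distrib[symmetric])
qed

lemma list_sgn_append:
  "distinct (xs @ ys) \<Longrightarrow>
    list_sgn (xs @ ys) = list_sgn xs * list_sgn ys * shuffle_sgn (set xs) (set ys)"
  by (induction xs) (auto simp: pos_sgn_Un shuffle_sgn_def)

lemma list_sgn_sorted: "sorted xs \<Longrightarrow> list_sgn xs = 1"
  by (induction xs) (auto simp: pos_sgn_below)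

section \<open>Submatrices and the Laplace expansion\<close>

lemma Collect_less_mem: "I \<subseteq> {..<n} \<Longrightarrow> {i. i < n \<and> i \<in> I} = I"
  by auto

lemma submatrix_carrier:
  assumes "M \<in> carrier_mat p q" "K \<subseteq> {..<p}" "L \<subseteq> {..<q}"
  shows "submatrix M K L \<in> carrier_mat (card K) (card L)"
  using assms by (auto simp: dim_submatrix Collect_less_mem)

lemma submatrix_entry:
  assumes "M \<in> carrier_mat p q" "K \<subseteq> {..<p}" "L \<subseteq> {..<q}" "i < card K" "j < card L"
  shows "submatrix M K L $$ (i, j) = M $$ (pick K i, pick L j)"
  using assms by (subst submatrix_index) (auto simp: Collect_less_mem)

lemma strict_mono_on_pick: "strict_mono_on {..<card S} (pick S)"
  by (rule strict_mono_onI) (simp add: pick_mono_le)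

lemma pick_image: "finite S \<Longrightarrow> pick S ` {..<card S} = S"
proof (rule card_subset_eq)
  show "pick S ` {..<card S} \<subseteq> S" by (auto simp: pick_in_set_le)
  show "card (pick S ` {..<card S}) = card S"
    by (simp add: card_image strict_mono_on_imp_inj_on[OF strict_mono_on_pick])
qed

lemma pick_lessThan: "i < n \<Longrightarrow> pick {..<n} i = i"
proof -
  assume "i < n"
  then have "{a \<in> {..<n}. a < i} = {..<i}" by auto
  then show ?thesis using pick_card_in_set[of i "{..<n}"] \<open>i < n\<close> by simp
qed

lemma submatrix_full: "M \<in> carrier_mat p q \<Longrightarrow> submatrix M {..<p} {..<q} = M"
  by (rule eq_matI) (auto simp: dim_submatrix submatrix_entry pick_lessThan Collect_less_mem)

lemma pick_Diff:
  assumes "finite S" "r < card S" "k < card S - 1"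
  shows "pick (S - {pick S r}) k = pick S (if k < r then k else Suc k)"
proof -
  define k' where "k' = (if k < r then k else Suc k)"
  define x where "x = pick S k'"
  have k': "k' < card S" "k' \<noteq> r" using assms by (auto simp: k'_def)
  then have x: "x \<in> S" by (simp add: x_def pick_in_set_le)
  have "x \<noteq> pick S r"
    using strict_mono_on_imp_inj_on[OF strict_mono_on_pick[of S]] k' assms(2)
    by (auto simp: x_def inj_on_def)
  have less: "pick S r < x \<longleftrightarrow> r < k'"
    unfolding x_def using strict_mono_on_less[OF strict_mono_on_pick] k' assms(2) by blast
  have "{a \<in> S - {pick S r}. a < x} = {a \<in> S. a < x} - {pick S r}" by auto
  moreover have "card {a \<in> S. a < x} = k'" using card_pick_le[OF k'(1)] by (simp add: x_def)
  moreover have "pick S r \<in> S" using assms(2) by (simp add: pick_in_set_le)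
  ultimately have "card {a \<in> S - {pick S r}. a < x} = (if r < k' then k' - 1 else k')"
    using assms(1) less by (auto simp: card_Diff_singleton_if)
  also have "\<dots> = k" using k'(2) by (auto simp: k'_def)
  finally have "pick (S - {pick S r}) k = x"
    using pick_card_in_set[of x "S - {pick S r}"] x \<open>x \<noteq> pick S r\<close> by simp
  then show ?thesis by (simp add: x_def k'_def)
qed

lemma mat_delete_submatrix:
  assumes "M \<in> carrier_mat p q" "K \<subseteq> {..<p}" "L \<subseteq> {..<q}" "r < card K" "s < card L"
  shows "mat_delete (submatrix M K L) r s = submatrix M (K - {pick K r}) (L - {pick L s})"
proof -
  have fin: "finite K" "finite L" using assms(2,3) by (auto intro: finite_subset)
  have in_KL: "pick K r \<in> K" "pick L s \<in> L" using assms(4,5) by (auto simp: pick_in_set_le)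
  have sub: "K - {pick K r} \<subseteq> {..<p}" "L - {pick L s} \<subseteq> {..<q}" using assms(2,3) by auto
  have card: "card (K - {pick K r}) = card K - 1" "card (L - {pick L s}) = card L - 1"
    using in_KL by auto
  show ?thesis
  proof (rule eq_matI)
    fix i j assume "i < dim_row (submatrix M (K - {pick K r}) (L - {pick L s}))"
      "j < dim_col (submatrix M (K - {pick K r}) (L - {pick L s}))"
    then have ij: "i < card K - 1" "j < card L - 1"
      using submatrix_carrier[OF assms(1) sub] card by auto
    have "mat_delete (submatrix M K L) r s $$ (i, j) = submatrix M K L $$
        (if i < r then i else Suc i, if j < s then j else Suc j)"
      using ij submatrix_carrier[OF assms(1-3)] by (simp add: mat_delete_def)
    also have "\<dots> = M $$ (pick K (if i < r then i else Suc i), pick L (if j < s then j else Suc j))"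
      using ij by (intro submatrix_entry[OF assms(1-3)]) auto
    also have "\<dots> = submatrix M (K - {pick K r}) (L - {pick L s}) $$ (i, j)"
      using ij card fin assms(4,5) by (simp add: submatrix_entry[OF assms(1) sub] pick_Diff)
    finally show "mat_delete (submatrix M K L) r s $$ (i, j)
        = submatrix M (K - {pick K r}) (L - {pick L s}) $$ (i, j)" .
  qed (use submatrix_carrier[OF assms(1-3)] submatrix_carrier[OF assms(1) sub] card in auto)
qed

text \<open>
  The Laplace expansion along a row, with rows and columns named by the elements of the index sets
  instead of their positions.
\<close>

lemma det_submatrix_row:
  fixes M :: "complex mat"
  assumes "M \<in> carrier_mat p q" "K \<subseteq> {..<p}" "L \<subseteq> {..<q}" "card K = card L" "i \<in> K"
  shows "det (submatrix M K L)
    = (\<Sum>l\<in>L. pos_sgn K i * pos_sgn L l * M $$ (i, l) * det (submatrix M (K - {i}) (L - {l})))"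
proof -
  have fin: "finite K" "finite L" using assms(2,3) by (auto intro: finite_subset)
  define r where "r = card {a \<in> K. a < i}"
  have pr: "pick K r = i" using assms(5) by (simp add: r_def pick_card_in_set)
  have r: "r < card K"
    unfolding r_def using fin assms(5) by (intro psubset_card_mono) auto
  let ?S = "submatrix M K L"
  have "det ?S = (\<Sum>c<card L. ?S $$ (r, c) * cofactor ?S r c)"
    using submatrix_carrier[OF assms(1-3)] assms(4) r by (intro laplace_expansion_row) auto
  also have "\<dots> = (\<Sum>c<card L. pos_sgn K i * pos_sgn L (pick L c) * M $$ (i, pick L c) *
      det (submatrix M (K - {i}) (L - {pick L c})))"
  proof (intro sum.cong refl)
    fix c assume "c \<in> {..<card L}"
    then have c: "c < card L" by simp
    have "pos_sgn K i * pos_sgn L (pick L c) = (-1) ^ (r + c)"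
      using card_pick_le[OF c] fin by (simp add: pos_sgn_card r_def power_add)
    then show "?S $$ (r, c) * cofactor ?S r c = pos_sgn K i * pos_sgn L (pick L c) *
        M $$ (i, pick L c) * det (submatrix M (K - {i}) (L - {pick L c}))"
      using c r by (simp add: cofactor_def submatrix_entry[OF assms(1-3)]
          mat_delete_submatrix[OF assms(1-3)] pr)
  qed
  also have "\<dots> = (\<Sum>l\<in>pick L ` {..<card L}. pos_sgn K i * pos_sgn L l * M $$ (i, l) *
      det (submatrix M (K - {i}) (L - {l})))"
    by (subst sum.reindex[OF strict_mono_on_imp_inj_on[OF strict_mono_on_pick]]) simp
  finally show ?thesis by (simp add: pick_image[OF fin(2)])
qed

lemma det_submatrix_empty:
  assumes "M \<in> carrier_mat p q"
  shows "det (submatrix M {} {}) = 1"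
proof -
  have "submatrix M {} {} \<in> carrier_mat 0 0"
    using submatrix_carrier[OF assms, of "{}" "{}"] by simp
  then show ?thesis by (simp add: det_dim_zero)
qed

section \<open>Signatures of permutations written as words\<close>

lemma det_permutation_mat:
  assumes "\<sigma> permutes {..<N}"
  shows "det (mat N N (\<lambda>(i, j). if j = \<sigma> i then 1 else 0 :: complex)) = of_int (sign \<sigma>)"
proof -
  let ?P = "mat N N (\<lambda>(i, j). if j = \<sigma> i then 1 else 0 :: complex)"
  have "det ?P = (\<Sum>\<tau> | \<tau> permutes {0..<N}. signof \<tau> * (\<Prod>i = 0..<N. ?P $$ (i, \<tau> i)))"
    by (rule det_def') simp
  also have "\<dots> = (\<Sum>\<tau> | \<tau> permutes {0..<N}. if \<tau> = \<sigma> then signof \<sigma> else 0)"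
  proof (intro sum.cong refl)
    fix \<tau> assume "\<tau> \<in> {\<tau>. \<tau> permutes {0..<N}}"
    then have \<tau>: "\<tau> permutes {..<N}" by (simp add: atLeast0LessThan)
    have entry: "?P $$ (i, \<tau> i) = (if \<tau> i = \<sigma> i then 1 else 0)" if "i < N" for i
      using that permutes_in_image[OF \<tau>, of i] by simp
    show "signof \<tau> * (\<Prod>i = 0..<N. ?P $$ (i, \<tau> i)) = (if \<tau> = \<sigma> then signof \<sigma> else 0)"
    proof (cases "\<tau> = \<sigma>")
      case False
      then obtain i where i: "\<tau> i \<noteq> \<sigma> i" by auto
      then have "i < N" using \<tau> assms by (metis lessThan_iff permutes_not_in)
      then have "(\<Prod>i = 0..<N. ?P $$ (i, \<tau> i)) = 0"
        using i entry[of i] by (intro prod_zero) auto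
      then show ?thesis using False by simp
    next
    case True
    have "?P $$ (i, \<tau> i) = 1" if "i \<in> {0..<N}" for i
      using entry[of i] that True by simp
    then have "(\<Prod>i = 0..<N. ?P $$ (i, \<tau> i)) = 1"
      by (intro prod.neutral ballI)
    then show ?thesis using True by simp
  qed
  qed
  also have "\<dots> = signof \<sigma>"
    using assms by (simp add: finite_permutations atLeast0LessThan)
  finally show ?thesis .
qed

text \<open>
  The signature of \<open>\<sigma>\<close> is the determinant of its permutation matrix. Expanding this determinant along
  its rows from the top downwards leaves one term in each step and produces the inversion signs of
  the word \<open>\<sigma> 0, \<sigma> 1, \<dots>\<close> one letter at a time.
\<close>

lemma list_sgn_permutes:
  assumes "\<sigma> permutes {..<N}"
  shows "list_sgn (map \<sigma> [0..<N]) = of_int (sign \<sigma>)"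
proof -
  define P where "P = mat N N (\<lambda>(i, j). if j = \<sigma> i then 1 else 0 :: complex)"
  have P: "P \<in> carrier_mat N N" by (simp add: P_def)
  have inj: "inj_on \<sigma> A" for A using assms by (meson inj_on_subset permutes_inj subset_UNIV)
  have lt: "\<sigma> i < N" if "i < N" for i using permutes_in_image[OF assms, of i] that by simp
  have "det (submatrix P {i..<N} (\<sigma> ` {i..<N})) = list_sgn (map \<sigma> [i..<N])" if "i \<le> N" for i
    using that
  proof (induction rule: inc_induct)
    case base
    then show ?case by (simp add: det_submatrix_empty[OF P])
  next
    case (step i)
    have Diff: "{i..<N} - {i} = {Suc i..<N}" by auto
    have img: "\<sigma> ` {i..<N} - {\<sigma> i} = \<sigma> ` {Suc i..<N}"
      using image_set_diff[OF inj[of UNIV], of "{i..<N}" "{i}"] by (simp add: Diff)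
    have set: "\<sigma> ` {i..<N} \<subseteq> {..<N}" using lt by auto
    have "det (submatrix P {i..<N} (\<sigma> ` {i..<N}))
        = (\<Sum>l\<in>\<sigma> ` {i..<N}. pos_sgn {i..<N} i * pos_sgn (\<sigma> ` {i..<N}) l * P $$ (i, l) *
            det (submatrix P ({i..<N} - {i}) (\<sigma> ` {i..<N} - {l})))"
      using step.hyps set by (intro det_submatrix_row[OF P]) (auto simp: card_image[OF inj])
    also have "\<dots> = (\<Sum>l\<in>\<sigma> ` {i..<N}. if l = \<sigma> i then pos_sgn (\<sigma> ` {i..<N}) (\<sigma> i) *
            det (submatrix P {Suc i..<N} (\<sigma> ` {Suc i..<N})) else 0)"
    proof (intro sum.cong refl)
      fix l assume "l \<in> \<sigma> ` {i..<N}"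
      then have "P $$ (i, l) = (if l = \<sigma> i then 1 else 0)"
        using step.hyps set by (auto simp: P_def)
      moreover have "pos_sgn {i..<N} i = 1" by (rule pos_sgn_below) simp
      ultimately show "pos_sgn {i..<N} i * pos_sgn (\<sigma> ` {i..<N}) l * P $$ (i, l) *
            det (submatrix P ({i..<N} - {i}) (\<sigma> ` {i..<N} - {l}))
          = (if l = \<sigma> i then pos_sgn (\<sigma> ` {i..<N}) (\<sigma> i) *
            det (submatrix P {Suc i..<N} (\<sigma> ` {Suc i..<N})) else 0)"
        by (simp add: Diff img)
    qed
    also have "\<dots> = pos_sgn (\<sigma> ` {i..<N}) (\<sigma> i) * det (submatrix P {Suc i..<N} (\<sigma> ` {Suc i..<N}))"
      using step.hyps by simp
    also have "\<dots> = pos_sgn (\<sigma> ` {Suc i..<N}) (\<sigma> i) * list_sgn (map \<sigma> [Suc i..<N])"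
      using pos_sgn_Diff_self[of "\<sigma> ` {i..<N}" "\<sigma> i"] by (simp add: img step.IH)
    also have "\<dots> = list_sgn (map \<sigma> [i..<N])"
      using step.hyps by (simp add: upt_conv_Cons)
    finally show ?case .
  qed
  from this[of 0] have "det (submatrix P {..<N} {..<N}) = list_sgn (map \<sigma> [0..<N])"
    using permutes_image[OF assms] by (simp add: atLeast0LessThan)
  then show ?thesis
    using det_permutation_mat[OF assms] by (simp add: submatrix_full[OF P] flip: P_def)
qed

lemma list_as_permutation:
  assumes "w \<in> permutations_of_set {..<N}"
  defines "\<sigma> \<equiv> (\<lambda>i. if i < N then w ! i else i)"
  shows "\<sigma> permutes {..<N}" "map \<sigma> [0..<N] = w"
proof -
  have w: "set w = {..<N}" "distinct w" "length w = N"
    using assms(1) by (auto dest: permutations_of_setD length_finite_permutations_of_set)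
  show map: "map \<sigma> [0..<N] = w"
    using w(3) by (intro nth_equalityI) (auto simp: \<sigma>_def)
  show "\<sigma> permutes {..<N}"
  proof (rule bij_imp_permutes)
    have "inj_on \<sigma> {..<N}" using w by (auto simp: \<sigma>_def inj_on_def nth_eq_iff_index_eq)
    moreover have "\<sigma> ` {..<N} = {..<N}"
      using arg_cong[OF map, of set] w(1) by (simp add: atLeast0LessThan)
    ultimately show "bij_betw \<sigma> {..<N} {..<N}" by (simp add: bij_betw_def)
  qed (simp add: \<sigma>_def)
qed

lemma sgn_split_eq_shuffle_sgn:
  assumes "K \<union> L = {..<m}" "K \<inter> L = {}"
  shows "sgn_split m K L = shuffle_sgn K L"
proof -
  have fin: "finite K" "finite L" using assms(1) by (metis finite_Un finite_lessThan)+
  define w where "w = sorted_list_of_set K @ sorted_list_of_set L"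
  have w: "w \<in> permutations_of_set {..<m}"
    using assms fin by (intro permutations_of_setI) (auto simp: w_def)
  have dist: "distinct w" using w by (rule permutations_of_setD)
  have "sgn_split m K L = list_sgn w"
    unfolding sgn_split_def w_def[symmetric]
    using list_sgn_permutes[OF list_as_permutation(1)[OF w]] list_as_permutation(2)[OF w] by simp
  also have "\<dots> = shuffle_sgn K L"
    using list_sgn_append[OF dist[unfolded w_def]] fin by (simp add: w_def list_sgn_sorted)
  finally show ?thesis .
qed

section \<open>Pfaffians indexed by finite sets\<close>

text \<open>
  The product of the entries of \<open>A\<close> at the consecutive pairs of letters of a word. The value \<open>0\<close> for
  words of odd length makes Pfaffians of odd size vanish.
\<close>

fun pair_prod :: "(nat \<Rightarrow> nat \<Rightarrow> complex) \<Rightarrow> nat list \<Rightarrow> complex" where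
  "pair_prod A [] = 1"
| "pair_prod A [x] = 0"
| "pair_prod A (x # y # xs) = A x y * pair_prod A xs"

text \<open>
  The Pfaffian of the array of the entries \<open>A i j\<close> with \<open>i\<close> and \<open>j\<close> in the finite set \<open>S\<close>. It is the sum over
  permutations, written as a sum over the words that contain each element of \<open>S\<close> once.
\<close>

definition pf_on :: "(nat \<Rightarrow> nat \<Rightarrow> complex) \<Rightarrow> nat set \<Rightarrow> complex" where
  "pf_on A S = 1 / (2 ^ (card S div 2) * fact (card S div 2)) *
     (\<Sum>w\<in>permutations_of_set S. list_sgn w * pair_prod A w)"

lemma pair_prod_odd: "odd (length w) \<Longrightarrow> pair_prod A w = 0"
  by (induction A w rule: pair_prod.induct) auto

lemma pair_prod_even:
  "even (length w) \<Longrightarrow> pair_prod A w = (\<Prod>i<length w div 2. A (w ! (2 * i)) (w ! (2 * i + 1)))"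
  by (induction A w rule: pair_prod.induct) (auto simp: prod.lessThan_Suc_shift simp del: prod.lessThan_Suc)

lemma pf_on_empty [simp]: "pf_on A {} = 1"
  by (simp add: pf_on_def)

lemma pf_on_odd: "odd (card S) \<Longrightarrow> pf_on A S = 0"
  by (auto simp: pf_on_def length_finite_permutations_of_set pair_prod_odd intro!: sum.neutral)

lemma sum_permutations_of_set:
  assumes "finite S" "S \<noteq> {}"
  shows "(\<Sum>w\<in>permutations_of_set S. g w)
    = (\<Sum>x\<in>S. \<Sum>w\<in>permutations_of_set (S - {x}). g (x # w))"
proof -
  have "(\<Sum>w\<in>permutations_of_set S. g w)
      = (\<Sum>x\<in>S. \<Sum>w\<in>(#) x ` permutations_of_set (S - {x}). g w)"
    unfolding permutations_of_set_nonempty[OF assms(2)]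
    using assms by (intro sum.UNION_disjoint) auto
  also have "\<dots> = (\<Sum>x\<in>S. \<Sum>w\<in>permutations_of_set (S - {x}). g (x # w))"
    by (simp add: sum.reindex)
  finally show ?thesis .
qed

text \<open>
  The expansion of a Pfaffian along a row, added up over all rows. Splitting off the first
  two letters of each word gives the sum on the right, and the factor \<open>card S\<close> on the left is the ratio
  of the normalizing factors \<open>2 ^ m * fact m\<close> for \<open>card S = 2 * m\<close> and \<open>card S = 2 * (m - 1)\<close>.
\<close>

lemma pf_on_recursion:
  assumes "finite S"
  shows "of_nat (card S) * pf_on A S
    = (\<Sum>i\<in>S. \<Sum>j\<in>S-{i}. pair_sgn S i j * A i j * pf_on A (S - {i, j}))"
proof (cases "even (card S) \<and> S \<noteq> {}")
  case False
  have "odd (card (S - {i, j}))" if "odd (card S)" "i \<in> S" "j \<in> S - {i}" for i j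
  proof -
    have "card S = Suc (Suc (card (S - {i, j})))"
      using that assms by (metis Diff_insert card_Suc_Diff1 finite_Diff Diff_insert2)
    then show ?thesis using that by simp
  qed
  then show ?thesis
    using False by (cases "S = {}") (auto simp: pf_on_odd intro!: sum.neutral)
next
  case True
  then obtain b where b: "card S = 2 * b" by (auto elim: evenE)
  moreover have "b \<noteq> 0" using b True assms by auto
  ultimately obtain m where S: "card S = 2 * Suc m" using not0_implies_Suc by blast
  define N where "N T = (\<Sum>w\<in>permutations_of_set T. list_sgn w * pair_prod A w)" for T
  have N: "N S = (\<Sum>i\<in>S. \<Sum>j\<in>S-{i}. pair_sgn S i j * A i j * N (S - {i, j}))"
  proof -
    have "N S = (\<Sum>i\<in>S. \<Sum>j\<in>S-{i}. \<Sum>w\<in>permutations_of_set (S - {i} - {j}).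
        list_sgn (i # j # w) * pair_prod A (i # j # w))"
    proof -
      have "S - {i} \<noteq> {}" if "i \<in> S" for i
      proof
        assume "S - {i} = {}"
        then have "card S \<le> card {i}" using assms by (intro card_mono) auto
        then show False using S by simp
      qed
      then show ?thesis
        unfolding N_def using assms True
        by (simp add: sum_permutations_of_set[of S] sum_permutations_of_set[of "S - {_}"] del: list_sgn.simps pair_prod.simps)
    qed
    also have "\<dots> = (\<Sum>i\<in>S. \<Sum>j\<in>S-{i}. pair_sgn S i j * A i j * N (S - {i, j}))"
    proof (intro sum.cong refl)
      fix i j assume ij: "i \<in> S" "j \<in> S - {i}"
      have "list_sgn (i # j # w) * pair_prod A (i # j # w)
          = pair_sgn S i j * A i j * (list_sgn w * pair_prod A w)"
        if "w \<in> permutations_of_set (S - {i} - {j})" for w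
      proof -
        have "set w = S - {i} - {j}" using that by (auto dest: permutations_of_setD)
        moreover have "insert j (S - {i} - {j}) = S - {i}" using ij by auto
        ultimately show ?thesis by (simp add: pair_sgn_def)
      qed
      then show "(\<Sum>w\<in>permutations_of_set (S - {i} - {j}). list_sgn (i # j # w) * pair_prod A (i # j # w))
          = pair_sgn S i j * A i j * N (S - {i, j})"
        unfolding N_def sum_distrib_left by (intro sum.cong) (simp_all add: Diff_insert2[of S i "{j}"])
    qed
    finally show ?thesis .
  qed
  have pfN: "pf_on A (S - {i, j}) = 1 / (2 ^ m * fact m) * N (S - {i, j})"
    if "i \<in> S" "j \<in> S - {i}" for i j
  proof -
    have "card (S - {i, j}) = 2 * m"
      using that S assms by (simp add: card_Diff_subset)
    then show ?thesis by (simp add: pf_on_def N_def)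
  qed
  have "of_nat (card S) * pf_on A S = of_nat (2 * Suc m) * (1 / (2 ^ Suc m * fact (Suc m)) * N S)"
    unfolding pf_on_def N_def S by simp
  also have "\<dots> = 1 / (2 ^ m * fact m) * N S"
    unfolding fact_Suc power_Suc of_nat_mult by (simp add: field_simps del: of_nat_Suc)
  also have "\<dots> = (\<Sum>i\<in>S. \<Sum>j\<in>S-{i}. pair_sgn S i j * A i j * pf_on A (S - {i, j}))"
    unfolding N sum_distrib_left by (intro sum.cong refl) (simp add: pfN)
  finally show ?thesis .
qed

text \<open>
  Agreement with the Pfaffian of a matrix: a permutation \<open>\<sigma>\<close> of \<open>{..<N}\<close> corresponds to the
  word \<open>\<sigma> 0, \<dots>, \<sigma> (N - 1)\<close>.
\<close>

lemma pfaffian_eq_pf_on: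
  assumes "A \<in> carrier_mat N N" "even N"
  shows "pfaffian A = pf_on (\<lambda>i j. A $$ (i, j)) {..<N}"
proof -
  define m where "m = N div 2"
  have N: "N = 2 * m" using assms(2) by (simp add: m_def)
  have "(\<Sum>\<sigma> | \<sigma> permutes {..<N}. of_int (sign \<sigma>) * (\<Prod>i<m. A $$ (\<sigma> (2 * i), \<sigma> (2 * i + 1))))
      = (\<Sum>w\<in>permutations_of_set {..<N}. list_sgn w * pair_prod (\<lambda>i j. A $$ (i, j)) w)"
  proof (rule sum.reindex_bij_witness[where i = "\<lambda>w i. if i < N then w ! i else i"
        and j = "\<lambda>\<sigma>. map \<sigma> [0..<N]"])
    fix \<sigma> assume "\<sigma> \<in> {\<sigma>. \<sigma> permutes {..<N}}"
    then have \<sigma>: "\<sigma> permutes {..<N}" by simp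
    show "(\<lambda>i. if i < N then map \<sigma> [0..<N] ! i else i) = \<sigma>"
      using permutes_not_in[OF \<sigma>] by auto
    show "map \<sigma> [0..<N] \<in> permutations_of_set {..<N}"
      using permutes_image[OF \<sigma>] permutes_inj[OF \<sigma>]
      by (intro permutations_of_setI) (auto simp: distinct_map atLeast0LessThan intro: inj_on_subset)
    have "pair_prod (\<lambda>i j. A $$ (i, j)) (map \<sigma> [0..<N]) = (\<Prod>i<m. A $$ (\<sigma> (2 * i), \<sigma> (2 * i + 1)))"
      by (auto simp: pair_prod_even N intro!: prod.cong)
    then show "list_sgn (map \<sigma> [0..<N]) * pair_prod (\<lambda>i j. A $$ (i, j)) (map \<sigma> [0..<N])
        = of_int (sign \<sigma>) * (\<Prod>i<m. A $$ (\<sigma> (2 * i), \<sigma> (2 * i + 1)))"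
      by (simp add: list_sgn_permutes[OF \<sigma>])
  qed (use list_as_permutation in auto)
  then show ?thesis
    using assms by (simp add: pfaffian_def pf_on_def N)
qed

lemma pf_on_vanish:
  assumes "finite S" "x \<in> S" "\<And>y. y \<in> S \<Longrightarrow> A x y = 0 \<and> A y x = 0"
  shows "pf_on A S = 0"
  using assms
proof (induction S rule: finite_psubset_induct)
  case (psubset S)
  have "of_nat (card S) * pf_on A S = 0"
    unfolding pf_on_recursion[OF \<open>finite S\<close>]
  proof (intro sum.neutral ballI)
    fix i j assume ij: "i \<in> S" "j \<in> S - {i}"
    show "pair_sgn S i j * A i j * pf_on A (S - {i, j}) = 0"
    proof (cases "i = x \<or> j = x")
      case True
      then show ?thesis using ij psubset.prems by auto
    next
      case False
      then have "pf_on A (S - {i, j}) = 0"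
        using ij psubset.prems by (intro psubset.IH) auto
      then show ?thesis by simp
    qed
  qed
  then show ?case using psubset by auto
qed

lemma pf_on_reindex:
  assumes "finite S" "inj_on f S"
    and eq: "\<And>T i j. T \<subseteq> S \<Longrightarrow> i \<in> T \<Longrightarrow> j \<in> T \<Longrightarrow> i \<noteq> j \<Longrightarrow>
      pair_sgn (f ` T) (f i) (f j) * A (f i) (f j) = pair_sgn T i j * B i j"
  shows "pf_on A (f ` S) = pf_on B S"
proof -
  have "finite T \<Longrightarrow> T \<subseteq> S \<Longrightarrow> pf_on A (f ` T) = pf_on B T" for T
  proof (induction T rule: finite_psubset_induct)
    case (psubset T)
    have inj: "inj_on f T" using psubset.prems assms(2) by (rule inj_on_subset[rotated])
    have img: "f ` T - {f i} = f ` (T - {i})" if "i \<in> T" for i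
      using inj that by (auto simp: inj_on_def)
    have img2: "f ` T - {f i, f j} = f ` (T - {i, j})" if "i \<in> T" "j \<in> T" for i j
      using inj that by (auto simp: inj_on_def)
    have "of_nat (card T) * pf_on A (f ` T)
        = (\<Sum>i\<in>T. \<Sum>j\<in>T-{i}. pair_sgn (f ` T) (f i) (f j) * A (f i) (f j) * pf_on A (f ` T - {f i, f j}))"
    proof -
      have "inj_on f (T - {i})" for i using inj by (rule inj_on_subset) auto
      then show ?thesis
        using pf_on_recursion[of "f ` T" A] psubset.hyps inj
        by (simp add: card_image sum.reindex img cong: sum.cong_simp)
    qed
    also have "\<dots> = (\<Sum>i\<in>T. \<Sum>j\<in>T-{i}. pair_sgn T i j * B i j * pf_on B (T - {i, j}))"
    proof (intro sum.cong refl)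
      fix i j assume ij: "i \<in> T" "j \<in> T - {i}"
      have "pf_on A (f ` T - {f i, f j}) = pf_on B (T - {i, j})"
        using ij psubset.prems img2 by (simp add: psubset.IH psubset_eq Diff_subset) (intro psubset.IH; auto)
      then show "pair_sgn (f ` T) (f i) (f j) * A (f i) (f j) * pf_on A (f ` T - {f i, f j})
          = pair_sgn T i j * B i j * pf_on B (T - {i, j})"
        using eq[of T i j] ij psubset.prems by simp
    qed
    also have "\<dots> = of_nat (card T) * pf_on B T"
      using pf_on_recursion[of T B] psubset.hyps by simp
    finally show ?case
      using psubset.hyps by (cases "T = {}") auto
  qed
  then show ?thesis using assms(1) by blast
qed

lemma pf_on_cong:
  assumes "finite S" "\<And>i j. i \<in> S \<Longrightarrow> j \<in> S \<Longrightarrow> A i j = B i j"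
  shows "pf_on A S = pf_on B S"
proof -
  have "pf_on A ((\<lambda>x. x) ` S) = pf_on B S"
    using assms by (intro pf_on_reindex) (auto simp: subset_iff)
  then show ?thesis by simp
qed

lemma pf_on_strict_mono:
  assumes "finite S" "strict_mono_on S f"
  shows "pf_on A (f ` S) = pf_on (\<lambda>i j. A (f i) (f j)) S"
proof (rule pf_on_reindex[OF assms(1) strict_mono_on_imp_inj_on[OF assms(2)]])
  fix T i j assume "T \<subseteq> S" "i \<in> T" "j \<in> T" "i \<noteq> j"
  then show "pair_sgn (f ` T) (f i) (f j) * A (f i) (f j) = pair_sgn T i j * A (f i) (f j)"
    using pair_sgn_strict_mono[OF monotone_on_subset[OF assms(2)], of T i j] by simp
qed

text \<open>
  Reversing the order negates each coefficient of the recursion, and this cancels the negation of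
  the entries.
\<close>

lemma pf_on_antimono:
  assumes "finite S" "strict_antimono_on S f"
    and neg: "\<And>i j. i \<in> S \<Longrightarrow> j \<in> S \<Longrightarrow> A (f i) (f j) = - B i j"
  shows "pf_on A (f ` S) = pf_on B S"
proof (rule pf_on_reindex[OF assms(1)])
  show "inj_on f S" using assms(2) by (simp add: strict_antimono_iff_antimono)
next
  fix T i j assume T: "T \<subseteq> S" "i \<in> T" "j \<in> T" "i \<noteq> j"
  then have "A (f i) (f j) = - B i j" by (intro neg) auto
  then show "pair_sgn (f ` T) (f i) (f j) * A (f i) (f j) = pair_sgn T i j * B i j"
    using pair_sgn_antimono[OF monotone_on_subset[OF assms(2)], of T i j] T
      finite_subset[OF _ assms(1), of T] by simp
qed

lemma insert_Diff_insert_pair: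
  "i \<in> T \<Longrightarrow> j \<in> T \<Longrightarrow> insert i (insert j (T - {i, j})) = T"
  by blast

lemma sum_Pow_pair_inside:
  fixes g :: "'a set \<Rightarrow> 'a \<Rightarrow> 'a \<Rightarrow> 'b::comm_monoid_add"
  assumes "finite S"
  shows "(\<Sum>T\<in>Pow S. \<Sum>i\<in>T. \<Sum>j\<in>T-{i}. g T i j)
    = (\<Sum>i\<in>S. \<Sum>j\<in>S-{i}. \<Sum>T\<in>Pow (S-{i,j}). g (insert i (insert j T)) i j)"
proof -
  have fin: "finite T" if "T \<subseteq> S" for T using that assms by (rule finite_subset)
  have "(\<Sum>T\<in>Pow S. \<Sum>i\<in>T. \<Sum>j\<in>T-{i}. g T i j)
      = (\<Sum>(T, i, j)\<in>(SIGMA T:Pow S. SIGMA i:T. T - {i}). g T i j)"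
    using assms fin by (simp add: sum.Sigma)
  also have "\<dots> = (\<Sum>(i, j, T)\<in>(SIGMA i:S. SIGMA j:S-{i}. Pow (S-{i,j})). g (insert i (insert j T)) i j)"
    by (rule sum.reindex_bij_witness[where i = "\<lambda>(i, j, T). (insert i (insert j T), i, j)"
          and j = "\<lambda>(T, i, j). (i, j, T - {i, j})"]) (auto simp: insert_Diff_insert_pair)
  also have "\<dots> = (\<Sum>i\<in>S. \<Sum>j\<in>S-{i}. \<Sum>T\<in>Pow (S-{i,j}). g (insert i (insert j T)) i j)"
    using assms by (simp add: sum.Sigma)
  finally show ?thesis .
qed

lemma sum_Pow_pair_outside:
  fixes g :: "'a set \<Rightarrow> 'a \<Rightarrow> 'a \<Rightarrow> 'b::comm_monoid_add"
  assumes "finite S"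
  shows "(\<Sum>T\<in>Pow S. \<Sum>i\<in>S-T. \<Sum>j\<in>S-T-{i}. g T i j)
    = (\<Sum>i\<in>S. \<Sum>j\<in>S-{i}. \<Sum>T\<in>Pow (S-{i,j}). g T i j)"
proof -
  have "(\<Sum>T\<in>Pow S. \<Sum>i\<in>S-T. \<Sum>j\<in>S-T-{i}. g T i j)
      = (\<Sum>(T, i, j)\<in>(SIGMA T:Pow S. SIGMA i:S-T. S-T-{i}). g T i j)"
    using assms by (simp add: sum.Sigma)
  also have "\<dots> = (\<Sum>(i, j, T)\<in>(SIGMA i:S. SIGMA j:S-{i}. Pow (S-{i,j})). g T i j)"
    by (rule sum.reindex_bij_witness[where i = "\<lambda>(i, j, T). (T, i, j)"
          and j = "\<lambda>(T, i, j). (i, j, T)"]) auto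
  also have "\<dots> = (\<Sum>i\<in>S. \<Sum>j\<in>S-{i}. \<Sum>T\<in>Pow (S-{i,j}). g T i j)"
    using assms by (simp add: sum.Sigma)
  finally show ?thesis .
qed

text \<open>
  The Pfaffian of a sum of two arrays. Expand the left-hand side by the recursion and the
  induction hypothesis. The terms with an entry of \<open>A\<close> recombine, by the recursion for \<open>A\<close>, to the terms on
  the right with weight \<open>card T\<close>, and those with an entry of \<open>B\<close> to the same terms with weight
  \<open>card (S - T)\<close>. The two weights add up to \<open>card S\<close>.
\<close>

lemma pf_on_add:
  assumes "finite S"
  shows "pf_on (\<lambda>i j. A i j + B i j) S
    = (\<Sum>T\<in>Pow S. shuffle_sgn T (S - T) * pf_on A T * pf_on B (S - T))"
  using assms
proof (induction S rule: finite_psubset_induct)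
  case (psubset S)
  define P where "P = pf_on (\<lambda>i j. A i j + B i j)"
  define t where "t T U = shuffle_sgn T U * pf_on A T * pf_on B U" for T U
  have fin: "finite T" if "T \<subseteq> S" for T using that psubset.hyps by (rule finite_subset)
  have L: "(\<Sum>T\<in>Pow S. of_nat (card T) * t T (S - T))
      = (\<Sum>i\<in>S. \<Sum>j\<in>S-{i}. pair_sgn S i j * A i j * (\<Sum>T\<in>Pow (S-{i,j}). t T (S - {i,j} - T)))"
  proof -
    have "(\<Sum>T\<in>Pow S. of_nat (card T) * t T (S - T))
        = (\<Sum>T\<in>Pow S. \<Sum>i\<in>T. \<Sum>j\<in>T-{i}.
            shuffle_sgn T (S - T) * pair_sgn T i j * A i j * pf_on A (T - {i, j}) * pf_on B (S - T))"
    proof (intro sum.cong refl)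
      fix T assume "T \<in> Pow S"
      then have "of_nat (card T) * pf_on A T
          = (\<Sum>i\<in>T. \<Sum>j\<in>T-{i}. pair_sgn T i j * A i j * pf_on A (T - {i, j}))"
        using fin by (intro pf_on_recursion) auto
      then have "of_nat (card T) * t T (S - T) = shuffle_sgn T (S - T) *
          (\<Sum>i\<in>T. \<Sum>j\<in>T-{i}. pair_sgn T i j * A i j * pf_on A (T - {i, j})) * pf_on B (S - T)"
        by (simp add: t_def mult_ac)
      then show "of_nat (card T) * t T (S - T) = (\<Sum>i\<in>T. \<Sum>j\<in>T-{i}.
            shuffle_sgn T (S - T) * pair_sgn T i j * A i j * pf_on A (T - {i, j}) * pf_on B (S - T))"
        by (simp add: sum_distrib_left sum_distrib_right mult.assoc)
    qed
    also have "\<dots> = (\<Sum>i\<in>S. \<Sum>j\<in>S-{i}. \<Sum>T\<in>Pow (S-{i,j}).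
        pair_sgn S i j * A i j * t T (S - {i,j} - T))"
      unfolding sum_Pow_pair_inside[OF psubset.hyps]
    proof (intro sum.cong refl)
      fix i j T assume ijT: "i \<in> S" "j \<in> S - {i}" "T \<in> Pow (S - {i, j})"
      define U where "U = S - {i, j} - T"
      have *: "S - insert i (insert j T) = U" "insert i (insert j T) - {i, j} = T"
        "insert i (insert j (T \<union> U)) = S"
        using ijT by (auto simp: U_def)
      have "pair_sgn (insert i (insert j (T \<union> U))) i j * shuffle_sgn T U
          = shuffle_sgn (insert i (insert j T)) U * pair_sgn (insert i (insert j T)) i j"
        using ijT fin[of T] psubset.hyps by (intro pair_sgn_shuffle_left) (auto simp: U_def)
      then show "shuffle_sgn (insert i (insert j T)) (S - insert i (insert j T)) *
          pair_sgn (insert i (insert j T)) i j * A i j * pf_on A (insert i (insert j T) - {i, j}) *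
          pf_on B (S - insert i (insert j T)) = pair_sgn S i j * A i j * t T (S - {i,j} - T)"
        unfolding * t_def U_def[symmetric] by (simp add: mult_ac) 
    qed
    finally show ?thesis by (simp add: sum_distrib_left)
  qed
  have R: "(\<Sum>T\<in>Pow S. of_nat (card (S - T)) * t T (S - T))
      = (\<Sum>i\<in>S. \<Sum>j\<in>S-{i}. pair_sgn S i j * B i j * (\<Sum>T\<in>Pow (S-{i,j}). t T (S - {i,j} - T)))"
  proof -
    have "(\<Sum>T\<in>Pow S. of_nat (card (S - T)) * t T (S - T))
        = (\<Sum>T\<in>Pow S. \<Sum>i\<in>S-T. \<Sum>j\<in>S-T-{i}.
            shuffle_sgn T (S - T) * pair_sgn (S - T) i j * B i j * pf_on A T * pf_on B (S - T - {i, j}))"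
    proof (intro sum.cong refl)
      fix T assume "T \<in> Pow S"
      have "of_nat (card (S - T)) * pf_on B (S - T)
          = (\<Sum>i\<in>S-T. \<Sum>j\<in>S-T-{i}. pair_sgn (S - T) i j * B i j * pf_on B (S - T - {i, j}))"
        using psubset.hyps by (intro pf_on_recursion) auto
      then have "of_nat (card (S - T)) * t T (S - T) = shuffle_sgn T (S - T) * pf_on A T *
          (\<Sum>i\<in>S-T. \<Sum>j\<in>S-T-{i}. pair_sgn (S - T) i j * B i j * pf_on B (S - T - {i, j}))"
        by (simp add: t_def mult_ac)
      then show "of_nat (card (S - T)) * t T (S - T) = (\<Sum>i\<in>S-T. \<Sum>j\<in>S-T-{i}.
            shuffle_sgn T (S - T) * pair_sgn (S - T) i j * B i j * pf_on A T * pf_on B (S - T - {i, j}))"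
        by (simp add: sum_distrib_left mult_ac)
    qed
    also have "\<dots> = (\<Sum>i\<in>S. \<Sum>j\<in>S-{i}. \<Sum>T\<in>Pow (S-{i,j}).
        pair_sgn S i j * B i j * t T (S - {i,j} - T))"
      unfolding sum_Pow_pair_outside[OF psubset.hyps]
    proof (intro sum.cong refl)
      fix i j T assume ijT: "i \<in> S" "j \<in> S - {i}" "T \<in> Pow (S - {i, j})"
      define U where "U = S - {i, j} - T"
      have *: "S - T = insert i (insert j U)" "insert i (insert j U) - {i, j} = U"
        "insert i (insert j (T \<union> U)) = S"
        using ijT by (auto simp: U_def)
      have "pair_sgn (insert i (insert j (T \<union> U))) i j * shuffle_sgn T U
          = shuffle_sgn T (insert i (insert j U)) * pair_sgn (insert i (insert j U)) i j"
        using ijT fin[of T] psubset.hyps by (intro pair_sgn_shuffle_right) (auto simp: U_def)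
      then show "shuffle_sgn T (S - T) * pair_sgn (S - T) i j * B i j * pf_on A T *
          pf_on B (S - T - {i, j}) = pair_sgn S i j * B i j * t T (S - {i,j} - T)"
        unfolding * t_def U_def[symmetric] by (simp add: mult_ac)
    qed
    finally show ?thesis by (simp add: sum_distrib_left)
  qed
  have "of_nat (card S) * P S
      = (\<Sum>i\<in>S. \<Sum>j\<in>S-{i}. pair_sgn S i j * (A i j + B i j) * (\<Sum>T\<in>Pow (S-{i,j}). t T (S - {i,j} - T)))"
    unfolding P_def pf_on_recursion[OF psubset.hyps]
    by (intro sum.cong refl arg_cong2[of _ _ _ _ "(*)"], unfold t_def, rule psubset.IH) auto
  also have "\<dots> = (\<Sum>T\<in>Pow S. of_nat (card T) * t T (S - T))
      + (\<Sum>T\<in>Pow S. of_nat (card (S - T)) * t T (S - T))"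
    unfolding L R by (simp add: sum.distrib distrib_left distrib_right)
  also have "\<dots> = (\<Sum>T\<in>Pow S. of_nat (card S) * t T (S - T))"
    unfolding sum.distrib[symmetric]
  proof (intro sum.cong refl)
    fix T assume "T \<in> Pow S"
    then have "card T + card (S - T) = card S"
      using psubset.hyps fin[of T] card_mono[of S T] by (simp add: card_Diff_subset)
    then show "of_nat (card T) * t T (S - T) + of_nat (card (S - T)) * t T (S - T)
        = of_nat (card S) * t T (S - T)"
      by (metis distrib_right of_nat_add)
  qed
  finally have "of_nat (card S) * P S = of_nat (card S) * (\<Sum>T\<in>Pow S. t T (S - T))"
    by (simp add: sum_distrib_left)
  then show ?case
    using psubset.hyps unfolding P_def t_def
    by (cases "S = {}") (simp_all add: shuffle_sgn_def)
qed

lemma pf_on_direct_sum: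
  assumes "finite K" "finite L" "\<And>k l. k \<in> K \<Longrightarrow> l \<in> L \<Longrightarrow> k < l"
    and A: "\<And>i j. i \<in> L \<Longrightarrow> j \<in> K \<union> L \<Longrightarrow> A i j = 0 \<and> A j i = 0"
    and B: "\<And>i j. i \<in> K \<Longrightarrow> j \<in> K \<union> L \<Longrightarrow> B i j = 0 \<and> B j i = 0"
  shows "pf_on (\<lambda>i j. A i j + B i j) (K \<union> L) = pf_on A K * pf_on B L"
proof -
  have disj: "K \<inter> L = {}" using assms(3) by fastforce
  have "pf_on (\<lambda>i j. A i j + B i j) (K \<union> L)
      = (\<Sum>T\<in>Pow (K \<union> L). shuffle_sgn T (K \<union> L - T) * pf_on A T * pf_on B (K \<union> L - T))"
    using assms by (intro pf_on_add) auto
  also have "\<dots> = (\<Sum>T\<in>{K}. shuffle_sgn T (K \<union> L - T) * pf_on A T * pf_on B (K \<union> L - T))"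
  proof (intro sum.mono_neutral_right ballI)
    fix T assume T: "T \<in> Pow (K \<union> L) - {K}"
    \<comment> \<open>either \<open>T\<close> contains an index whose row in \<open>A\<close> is zero, or its complement contains one whose
      row in \<open>B\<close> is zero\<close>
    then have fin: "finite T" using assms(1,2) by (auto intro: finite_subset)
    consider x where "x \<in> T" "x \<in> L" | x where "x \<in> K" "x \<notin> T"
      using T by auto
    then show "shuffle_sgn T (K \<union> L - T) * pf_on A T * pf_on B (K \<union> L - T) = 0"
    proof cases
      case 1
      then have "pf_on A T = 0" using T fin A by (intro pf_on_vanish[of _ x]) auto
      then show ?thesis by simp
    next
      case 2
      then have "pf_on B (K \<union> L - T) = 0" using assms(1,2) B by (intro pf_on_vanish[of _ x]) auto
      then show ?thesis by simp
    qed
  qed (use assms(1,2) in auto)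
  also have "\<dots> = pf_on A K * pf_on B L"
  proof -
    have "K \<union> L - K = L" using disj by auto
    moreover have "shuffle_sgn K L = 1" using assms(3) by (intro shuffle_sgn_below) (simp add: less_imp_le)
    ultimately show ?thesis by simp
  qed
  finally show ?thesis .
qed

section \<open>The block expansion\<close>

lemma pfaffian_submatrix:
  assumes "M \<in> carrier_mat p p" "I \<subseteq> {..<p}" "even (card I)"
  shows "pfaffian (submatrix M I I) = pf_on (\<lambda>i j. M $$ (i, j)) I"
proof -
  have "pfaffian (submatrix M I I) = pf_on (\<lambda>i j. submatrix M I I $$ (i, j)) {..<card I}"
    using assms by (intro pfaffian_eq_pf_on submatrix_carrier) auto
  also have "\<dots> = pf_on (\<lambda>i j. M $$ (pick I i, pick I j)) {..<card I}"
    using assms by (intro pf_on_cong) (auto simp: submatrix_entry)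
  also have "\<dots> = pf_on (\<lambda>i j. M $$ (i, j)) (pick I ` {..<card I})"
    by (rule pf_on_strict_mono[symmetric]) (simp_all add: strict_mono_on_pick)
  also have "pick I ` {..<card I} = I"
    using assms(2) by (intro pick_image) (auto intro: finite_subset)
  finally show ?thesis .
qed

text \<open>
  If the only nonzero entries pair \<open>{..<p}\<close> with the reversed copy \<open>f ` {..<q}\<close> of \<open>{..<q}\<close>, then the
  Pfaffian is a minor. When \<open>|K| = |L|\<close>, antisymmetry turns the recursion into twice the sum of the
  Laplace expansions of the minor along all of its rows. The sign of \<open>f l\<close> agrees with that of \<open>l\<close>, since \<open>f l\<close> passes over
  the remaining \<open>|K| - 1\<close> elements of \<open>K\<close> and the reversal of \<open>L\<close> contributes the sign
  \<open>(-1) ^ (|L| - 1)\<close>.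
\<close>

lemma pf_on_bipartite:
  fixes M :: "complex mat"
  assumes M: "M \<in> carrier_mat p q" and K: "K \<subseteq> {..<p}" and L: "L \<subseteq> {..<q}"
    and f: "strict_antimono_on {..<q} f" "\<And>j. j < q \<Longrightarrow> p \<le> f j"
    and zero: "\<And>i j. i < p \<Longrightarrow> j < p \<Longrightarrow> A i j = 0"
      "\<And>i j. i < q \<Longrightarrow> j < q \<Longrightarrow> A (f i) (f j) = 0"
    and mixed: "\<And>i j. i < p \<Longrightarrow> j < q \<Longrightarrow> A i (f j) = M $$ (i, j)"
      "\<And>i j. i < p \<Longrightarrow> j < q \<Longrightarrow> A (f j) i = - M $$ (i, j)"
  shows "pf_on A (K \<union> f ` L) = (if card K = card L then det (submatrix M K L) else 0)"
proof -
  have "finite K" using K by (auto intro: finite_subset)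
  then show ?thesis using K L
  proof (induction K arbitrary: L rule: finite_psubset_induct)
    case (psubset K)
    note K = \<open>K \<subseteq> {..<p}\<close> and L = \<open>L \<subseteq> {..<q}\<close> and finK = \<open>finite K\<close>
    have finL: "finite L" using L by (auto intro: finite_subset)
    have anti: "strict_antimono_on L f" using f(1) L by (rule monotone_on_subset)
    then have inj: "inj_on f L" by (simp add: strict_antimono_iff_antimono)
    have K_less: "i < p" if "i \<in> K" for i using that K by auto
    have L_less: "l < q" if "l \<in> L" for l using that L by auto
    have less: "i < f l" if "i \<in> K" "l \<in> L" for i l
      using K_less[OF that(1)] f(2)[OF L_less[OF that(2)]] by simp
    then have disj: "K \<inter> f ` L = {}" by fastforce
    define S where "S = K \<union> f ` L"
    have finS: "finite S" using finK finL by (simp add: S_def)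
    show ?case
    proof (cases "K = {}")
      case True
      show ?thesis
      proof (cases "L = {}")
        case True
        then show ?thesis using \<open>K = {}\<close> by (simp add: det_submatrix_empty[OF M])
      next
        case False
        then obtain l where "l \<in> L" by auto
        then have "pf_on A (f ` L) = 0"
          using finL L_less by (intro pf_on_vanish[of _ "f l"]) (auto simp: zero)
        then show ?thesis using \<open>K = {}\<close> False finL by auto
      qed
    next
      case False
      define R where "R = (if card K = card L then det (submatrix M K L) else 0)"
      define g where "g i j = pair_sgn S i j * A i j * pf_on A (S - {i, j})" for i j
      have g_sym: "g j i = g i j" if "i \<in> K" "j \<in> f ` L" for i j
      proof -
        have "i \<noteq> j" using that disj by auto
        then have "pair_sgn S j i = - pair_sgn S i j"
          using that finS by (intro pair_sgn_swap) (auto simp: S_def)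
        moreover have "A j i = - A i j"
          using that mixed K_less L_less by auto
        ultimately show ?thesis by (simp add: g_def insert_commute)
      qed
      have row: "(\<Sum>j\<in>f ` L. g i j) = R" if i: "i \<in> K" for i
      proof -
        have "(\<Sum>j\<in>f ` L. g i j) = (\<Sum>l\<in>L. g i (f l))" by (simp add: sum.reindex[OF inj])
        also have "\<dots> = (\<Sum>l\<in>L. if card K = card L then pos_sgn K i * pos_sgn L l * M $$ (i, l) *
            det (submatrix M (K - {i}) (L - {l})) else 0)"
        proof (intro sum.cong refl)
          fix l assume l: "l \<in> L"
          have "S - {i, f l} = (K - {i}) \<union> f ` (L - {l})"
            using disj i l inj by (auto simp: S_def inj_on_def)
          moreover have "pf_on A ((K - {i}) \<union> f ` (L - {l}))
              = (if card (K - {i}) = card (L - {l}) then det (submatrix M (K - {i}) (L - {l})) else 0)"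
            using i psubset.prems by (intro psubset.IH) auto
          moreover have "card (K - {i}) = card (L - {l}) \<longleftrightarrow> card K = card L"
            using i l finK finL by (metis card_Suc_Diff1 nat.inject)
          moreover have "pair_sgn S i (f l) = pos_sgn K i * pos_sgn L l" if eq: "card K = card L"
          proof -
            have "S - {i} = (K - {i}) \<union> f ` L" using disj i by (auto simp: S_def)
            moreover have "pos_sgn (f ` L) i = 1"
              using less[OF i] by (intro pos_sgn_below) (auto simp: less_imp_le)
            moreover have "pos_sgn (K - {i}) (f l) = (-1) ^ card (K - {i})"
              using less[OF _ l] by (intro pos_sgn_above) auto
            moreover have "pos_sgn (f ` L) (f l) = (-1) ^ (card L - 1) * pos_sgn L l"
              by (rule pos_sgn_antimono[OF anti finL l])
            moreover have "K \<inter> f ` L = {}" "(K - {i}) \<inter> f ` L = {}" using disj by auto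
            ultimately show ?thesis
              using i eq finK finL
              by (simp add: pair_sgn_def S_def pos_sgn_Un power_mult_distrib[symmetric] del: Un_Diff)
          qed
          ultimately show "g i (f l) = (if card K = card L then pos_sgn K i * pos_sgn L l * M $$ (i, l) *
              det (submatrix M (K - {i}) (L - {l})) else 0)"
            using K_less[OF i] L_less[OF l] by (simp add: g_def mixed)
        qed
        also have "\<dots> = R"
          using det_submatrix_row[OF M K L _ i] by (simp add: R_def)
        finally show ?thesis .
      qed
      have "of_nat (card S) * pf_on A S = (\<Sum>i\<in>S. \<Sum>j\<in>S-{i}. g i j)"
        unfolding g_def by (rule pf_on_recursion[OF finS])
      also have "\<dots> = (\<Sum>i\<in>K. \<Sum>j\<in>S-{i}. g i j) + (\<Sum>i\<in>f ` L. \<Sum>j\<in>S-{i}. g i j)"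
        using finK finL disj by (simp add: S_def sum.union_disjoint)
      also have "(\<Sum>i\<in>K. \<Sum>j\<in>S-{i}. g i j) = (\<Sum>i\<in>K. \<Sum>j\<in>f ` L. g i j)"
        using finS disj K_less
        by (intro sum.cong refl sum.mono_neutral_right) (auto simp: S_def g_def zero)
      also have "(\<Sum>i\<in>f ` L. \<Sum>j\<in>S-{i}. g i j) = (\<Sum>i\<in>f ` L. \<Sum>j\<in>K. g i j)"
        using finS disj L_less
        by (intro sum.cong refl sum.mono_neutral_right) (auto simp: S_def g_def zero)
      also have "\<dots> = (\<Sum>i\<in>K. \<Sum>j\<in>f ` L. g i j)"
        by (subst sum.swap) (intro sum.cong refl g_sym)
      also have "(\<Sum>i\<in>K. \<Sum>j\<in>f ` L. g i j) = of_nat (card K) * R"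
        by (simp add: row)
      also have "of_nat (card K) * R + of_nat (card K) * R = of_nat (card S) * R"
        using finK finL disj
        by (simp add: R_def S_def card_Un_disjoint card_image[OF inj] distrib_right)
      finally have "pf_on A S = R"
        using False finS by (auto simp: S_def)
      then show ?thesis by (simp add: S_def R_def)
    qed
  qed
qed

text \<open>
  Write \<open>A\<close> as the sum of its mixed part \<open>Am\<close>, its part \<open>Ab\<close> on the indices below \<open>p\<close> and its
  part \<open>Ac\<close> on the other indices. In the Pfaffian of \<open>Am + (Ab + Ac)\<close>, the set indexing the second summand is \<open>I \<union> f ` J\<close>
  for unique \<open>I\<close> and \<open>J\<close>.
\<close>

lemma pf_on_block_expansion:
  fixes M :: "complex mat"
  assumes M: "M \<in> carrier_mat p q"
    and f: "strict_antimono_on {..<q} f" "\<And>j. j < q \<Longrightarrow> p \<le> f j"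
    and mixed: "\<And>i j. i < p \<Longrightarrow> j < q \<Longrightarrow> A i (f j) = M $$ (i, j)"
      "\<And>i j. i < p \<Longrightarrow> j < q \<Longrightarrow> A (f j) i = - M $$ (i, j)"
  shows "pf_on A ({..<p} \<union> f ` {..<q}) = (\<Sum>(I, J)\<in>Pow {..<p} \<times> Pow {..<q}.
    shuffle_sgn (({..<p} - I) \<union> f ` ({..<q} - J)) (I \<union> f ` J) *
    (if card ({..<p} - I) = card ({..<q} - J) then det (submatrix M ({..<p} - I) ({..<q} - J)) else 0) *
    (pf_on A I * pf_on A (f ` J)))"
proof -
  define S where "S = {..<p} \<union> f ` {..<q}"
  define Am where "Am i j = (if i < p \<longleftrightarrow> j < p then 0 else A i j)" for i j
  define Ab where "Ab i j = (if i < p \<and> j < p then A i j else 0)" for i j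
  define Ac where "Ac i j = (if p \<le> i \<and> p \<le> j then A i j else 0)" for i j
  have inj: "inj_on f {..<q}" using f(1) by (simp add: strict_antimono_iff_antimono)
  have A: "A = (\<lambda>i j. Am i j + (Ab i j + Ac i j))"
    by (auto simp: Am_def Ab_def Ac_def fun_eq_iff)
  have f_less [simp]: "\<not> f j < p" if "j < q" for j using f(2)[OF that] by simp
  have compl: "S - (({..<p} - I) \<union> f ` ({..<q} - J)) = I \<union> f ` J"
    if "I \<subseteq> {..<p}" "J \<subseteq> {..<q}" for I J
  proof (rule Set.set_eqI)
    fix x
    consider "x < p" | j where "j < q" "x = f j" | "x \<notin> S"
      by (auto simp: S_def)
    then show "x \<in> S - (({..<p} - I) \<union> f ` ({..<q} - J)) \<longleftrightarrow> x \<in> I \<union> f ` J"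
    proof cases
      case 1
      then have "x \<notin> f ` {..<q}" by auto
      then show ?thesis using 1 that by (auto simp: S_def)
    next
      case (2 j)
      then have "x \<in> f ` A \<longleftrightarrow> j \<in> A" if "A \<subseteq> {..<q}" for A
        using inj_on_image_mem_iff[OF inj _ that] by simp
      then show ?thesis using 2 that by (auto simp: S_def)
    next
      case 3
      then show ?thesis using that by (auto simp: S_def)
    qed
  qed
  have "pf_on A S = (\<Sum>T\<in>Pow S. shuffle_sgn T (S - T) * pf_on Am T * pf_on (\<lambda>i j. Ab i j + Ac i j) (S - T))"
    by (subst A, rule pf_on_add) (simp add: S_def)
  also have "\<dots> = (\<Sum>(I, J)\<in>Pow {..<p} \<times> Pow {..<q}.
    shuffle_sgn (({..<p} - I) \<union> f ` ({..<q} - J)) (I \<union> f ` J) *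
    pf_on Am (({..<p} - I) \<union> f ` ({..<q} - J)) * pf_on (\<lambda>i j. Ab i j + Ac i j) (I \<union> f ` J))"
  proof (rule sum.reindex_bij_witness[where i = "\<lambda>(I, J). ({..<p} - I) \<union> f ` ({..<q} - J)"
        and j = "\<lambda>T. ({..<p} - T, {j \<in> {..<q}. f j \<notin> T})"])
    fix T assume T: "T \<in> Pow S"
    have *: "({..<p} - ({..<p} - T)) \<union> f ` ({..<q} - {j \<in> {..<q}. f j \<notin> T}) = T"
      using T by (auto simp: S_def)
    then show "(case ({..<p} - T, {j \<in> {..<q}. f j \<notin> T}) of
        (I, J) \<Rightarrow> ({..<p} - I) \<union> f ` ({..<q} - J)) = T" by simp
    show "({..<p} - T, {j \<in> {..<q}. f j \<notin> T}) \<in> Pow {..<p} \<times> Pow {..<q}" by auto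
    show "(case ({..<p} - T, {j \<in> {..<q}. f j \<notin> T}) of (I, J) \<Rightarrow>
        shuffle_sgn (({..<p} - I) \<union> f ` ({..<q} - J)) (I \<union> f ` J) *
        pf_on Am (({..<p} - I) \<union> f ` ({..<q} - J)) * pf_on (\<lambda>i j. Ab i j + Ac i j) (I \<union> f ` J))
      = shuffle_sgn T (S - T) * pf_on Am T * pf_on (\<lambda>i j. Ab i j + Ac i j) (S - T)"
      using compl[OF Diff_subset Collect_restrict, of T "\<lambda>j. f j \<notin> T"]
      unfolding * prod.case by simp
  next
    fix IJ assume "IJ \<in> Pow {..<p} \<times> Pow {..<q}"
    then obtain I J where IJ: "IJ = (I, J)" "I \<subseteq> {..<p}" "J \<subseteq> {..<q}" by auto
    show "(case IJ of (I, J) \<Rightarrow> ({..<p} - I) \<union> f ` ({..<q} - J)) \<in> Pow S"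
      using IJ by (auto simp: S_def)
    have "{..<p} - (({..<p} - I) \<union> f ` ({..<q} - J)) = I"
      using IJ by auto
    moreover have "{j \<in> {..<q}. f j \<notin> ({..<p} - I) \<union> f ` ({..<q} - J)} = J"
      using IJ inj by (auto simp: inj_on_def)
    ultimately show "({..<p} - (case IJ of (I, J) \<Rightarrow> ({..<p} - I) \<union> f ` ({..<q} - J)),
        {j \<in> {..<q}. f j \<notin> (case IJ of (I, J) \<Rightarrow> ({..<p} - I) \<union> f ` ({..<q} - J))}) = IJ"
      by (simp add: IJ(1))
  qed
  also have "\<dots> = (\<Sum>(I, J)\<in>Pow {..<p} \<times> Pow {..<q}.
    shuffle_sgn (({..<p} - I) \<union> f ` ({..<q} - J)) (I \<union> f ` J) *
    (if card ({..<p} - I) = card ({..<q} - J) then det (submatrix M ({..<p} - I) ({..<q} - J)) else 0) *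
    (pf_on A I * pf_on A (f ` J)))"
  proof (intro sum.cong refl, clarify)
    fix I J assume IJ: "I \<subseteq> {..<p}" "J \<subseteq> {..<q}"
    then have fin: "finite I" "finite J" by (auto intro: finite_subset)
    have I_less: "i < p" if "i \<in> I" for i using that IJ by auto
    have J_ge: "\<not> f j < p" "p \<le> f j" if "j \<in> J" for j using that IJ f(2)[of j] by auto
    have "pf_on Am (({..<p} - I) \<union> f ` ({..<q} - J)) =
        (if card ({..<p} - I) = card ({..<q} - J) then det (submatrix M ({..<p} - I) ({..<q} - J)) else 0)"
      by (rule pf_on_bipartite[OF M _ _ f]) (auto simp: Am_def mixed)
    moreover have "pf_on (\<lambda>i j. Ab i j + Ac i j) (I \<union> f ` J) = pf_on Ab I * pf_on Ac (f ` J)"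
      using fin I_less J_ge
      by (intro pf_on_direct_sum) (force simp: Ab_def Ac_def)+
    moreover have "pf_on Ab I = pf_on A I"
      using fin I_less by (intro pf_on_cong) (auto simp: Ab_def)
    moreover have "pf_on Ac (f ` J) = pf_on A (f ` J)"
      using fin J_ge by (intro pf_on_cong) (auto simp: Ac_def)
    ultimately show "shuffle_sgn (({..<p} - I) \<union> f ` ({..<q} - J)) (I \<union> f ` J) *
        pf_on Am (({..<p} - I) \<union> f ` ({..<q} - J)) * pf_on (\<lambda>i j. Ab i j + Ac i j) (I \<union> f ` J)
      = shuffle_sgn (({..<p} - I) \<union> f ` ({..<q} - J)) (I \<union> f ` J) *
        (if card ({..<p} - I) = card ({..<q} - J) then det (submatrix M ({..<p} - I) ({..<q} - J)) else 0) *
        (pf_on A I * pf_on A (f ` J))"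
      by simp
  qed
  finally show ?thesis by (simp add: S_def)
qed

text \<open>
  Each element of \<open>f ` L\<close> passes over all of \<open>I\<close>, and the reversal of the order within \<open>L \<union> J\<close> changes
  all comparisons between \<open>L\<close> and \<open>J\<close>. The numbers \<open>|L| |I|\<close> and \<open>|L| |J|\<close> of sign changes are even.
\<close>

lemma shuffle_sgn_blocks:
  assumes "K \<union> I = {..<p}" "K \<inter> I = {}" "L \<union> J = {..<q}" "L \<inter> J = {}"
    and f: "strict_antimono_on {..<q} f" "\<And>j. j < q \<Longrightarrow> p \<le> f j"
    and "even (card I)" "even (card J)"
  shows "shuffle_sgn (K \<union> f ` L) (I \<union> f ` J) = sgn_split p K I * sgn_split q L J"
proof -
  have fin: "finite K" "finite I" "finite L" "finite J"
    using assms(1,3) by (metis finite_Un finite_lessThan)+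
  have inj: "inj_on f {..<q}" using f(1) by (simp add: strict_antimono_iff_antimono)
  have KI: "x < p" if "x \<in> K \<or> x \<in> I" for x using that assms(1) by auto
  have LJ: "p \<le> f x" if "x \<in> L \<or> x \<in> J" for x using that assms(3) by (intro f(2)) auto
  have disj: "K \<inter> f ` L = {}" "I \<inter> f ` J = {}"
    using KI LJ by (fastforce simp: not_le[symmetric])+
  have "shuffle_sgn K (f ` J) = 1"
    using KI LJ by (intro shuffle_sgn_below) (force intro: less_imp_le order.strict_trans2)
  moreover have "shuffle_sgn (f ` L) I = (-1) ^ (card I * card (f ` L))"
    using KI LJ by (intro shuffle_sgn_above) (force intro: order.strict_trans2)
  moreover have "shuffle_sgn (f ` L) (f ` J) = (-1) ^ (card J * card L) * shuffle_sgn L J"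
    using f(1) fin assms(3,4) by (intro shuffle_sgn_antimono) auto
  ultimately show ?thesis
    using fin disj assms by (simp add: shuffle_sgn_Un_left shuffle_sgn_Un_right sgn_split_eq_shuffle_sgn)
qed

theorem theorem3p2:
  fixes p q n r \<epsilon> :: nat and X a B C b c :: "complex mat"
  assumes "p > 0" and "q > 0" and "p + q = 2 * n"
    and "r = min p q"
    and "\<epsilon> = (if even p then 0 else 1)"
    and "X \<in> orth_lie (2 * n)"
    and "a \<in> carrier_mat p q" and "B \<in> carrier_mat p p" and "C \<in> carrier_mat q q"
    and "X = four_block_mat a B C (- (antidiag_mat q * transpose_mat a * antidiag_mat p))"
    and "b = mat p p (\<lambda>(i, j). X $$ (i, neg_idx n j))"
    and "c = mat q q (\<lambda>(i, j). X $$ (neg_idx n j, i))"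
  shows "Pf_orth X =
    (\<Sum>k = 0..r div 2.
      \<Sum>(I, J) | I \<subseteq> {..<p} \<and> J \<subseteq> {..<q} \<and>
                 card ({..<p} - I) = 2 * k + \<epsilon> \<and> card ({..<q} - J) = 2 * k + \<epsilon>.
        sgn_split p ({..<p} - I) I * sgn_split q ({..<q} - J) J *
        det (submatrix a ({..<p} - I) ({..<q} - J)) *
        pfaffian (submatrix b I I) * pfaffian (submatrix c J J))"
proof -
  let ?P = "{..<p}" and ?Q = "{..<q}"
  define f where "f = neg_idx n"
  note pq = \<open>p + q = 2 * n\<close> and a = \<open>a \<in> carrier_mat p q\<close>
  have X: "X \<in> carrier_mat (2 * n) (2 * n)" using \<open>X \<in> orth_lie (2 * n)\<close> by (simp add: orth_lie_def)
  define A where "A i j = (X * antidiag_mat (2 * n)) $$ (i, j)" for i j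
  have A: "A i j = X $$ (i, f j)" if ij: "i < 2 * n" "j < 2 * n" for i j
  proof -
    have "A i j = (\<Sum>l = 0..<2 * n. X $$ (i, l) * antidiag_mat (2 * n) $$ (l, j))"
      unfolding A_def using X ij by (intro mat_mult_index) (auto simp: antidiag_mat_def)
    also have "\<dots> = (\<Sum>l = 0..<2 * n. if l = f j then X $$ (i, l) else 0)"
      using ij by (intro sum.cong) (auto simp: antidiag_mat_def f_def neg_idx_def)
    finally show ?thesis using ij by (simp add: f_def neg_idx_def)
  qed
  have f_anti: "strict_antimono_on ?Q f"
    using pq by (intro monotone_onI) (auto simp: f_def neg_idx_def)
  have f_ge: "p \<le> f j" if "j < q" for j
    using pq that by (simp add: f_def neg_idx_def)
  have f_lt: "f j < 2 * n" and f_f: "f (f j) = j" if "j < 2 * n" for j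
    using that by (simp_all add: f_def neg_idx_def)
  have X_anti: "X $$ (f j, f i) = - X $$ (i, j)" if "i < 2 * n" "j < 2 * n" for i j
    using orth_lie_antisym[OF \<open>X \<in> orth_lie (2 * n)\<close> that] by (simp add: f_def neg_idx_def)
  have S: "?P \<union> f ` ?Q = {..<2 * n}"
  proof
    show "{..<2 * n} \<subseteq> ?P \<union> f ` ?Q"
    proof
      fix x assume "x \<in> {..<2 * n}"
      then have "x < p \<or> (f x < q \<and> x = f (f x))" using pq by (auto simp: f_def neg_idx_def)
      then show "x \<in> ?P \<union> f ` ?Q" by blast
    qed
  qed (use pq f_lt in auto)
  have mixed: "A i (f j) = a $$ (i, j)" "A (f j) i = - a $$ (i, j)" if "i < p" "j < q" for i j
  proof -
    have lt: "i < 2 * n" "j < 2 * n" using that pq by auto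
    have "X $$ (i, j) = a $$ (i, j)"
      using that a pq \<open>C \<in> carrier_mat q q\<close> \<open>B \<in> carrier_mat p p\<close>
      by (simp add: \<open>X = four_block_mat _ _ _ _\<close>)
    then show "A i (f j) = a $$ (i, j)" "A (f j) i = - a $$ (i, j)"
      using lt X_anti[OF lt] by (simp_all add: A f_lt f_f)
  qed
  define t where "t I J = sgn_split p (?P - I) I * sgn_split q (?Q - J) J *
        det (submatrix a (?P - I) (?Q - J)) *
        pfaffian (submatrix b I I) * pfaffian (submatrix c J J)" for I J
  \<comment> \<open>the index pairs whose terms can be nonzero\<close>
  define D where "D = {(I, J). I \<subseteq> ?P \<and> J \<subseteq> ?Q \<and> card (?P - I) = card (?Q - J) \<and> even (card I)}"
  have D_sub: "D \<subseteq> Pow ?P \<times> Pow ?Q" by (auto simp: D_def)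
  have card_compl: "card ({..<N} - I) = N - card I" "card I \<le> N" if "I \<subseteq> {..<N}" for I N
    using that card_mono[OF _ that] by (auto simp: card_Diff_subset finite_subset[OF that])
  have "Pf_orth X = pf_on A (?P \<union> f ` ?Q)"
    using X unfolding S Pf_orth_def A_def by (subst pfaffian_eq_pf_on) (auto simp: antidiag_mat_def)
  also have "\<dots> = (\<Sum>(I, J)\<in>Pow ?P \<times> Pow ?Q.
      shuffle_sgn ((?P - I) \<union> f ` (?Q - J)) (I \<union> f ` J) *
      (if card (?P - I) = card (?Q - J) then det (submatrix a (?P - I) (?Q - J)) else 0) *
      (pf_on A I * pf_on A (f ` J)))"
    by (rule pf_on_block_expansion[OF a f_anti f_ge mixed])
  also have "\<dots> = (\<Sum>(I, J)\<in>D. shuffle_sgn ((?P - I) \<union> f ` (?Q - J)) (I \<union> f ` J) *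
      (if card (?P - I) = card (?Q - J) then det (submatrix a (?P - I) (?Q - J)) else 0) *
      (pf_on A I * pf_on A (f ` J)))"
    using D_sub by (intro sum.mono_neutral_right) (auto simp: D_def pf_on_odd)
  also have "\<dots> = (\<Sum>(I, J)\<in>D. t I J)"
  proof (intro sum.cong refl, clarify)
    fix I J assume "(I, J) \<in> D"
    then have I: "I \<subseteq> ?P" and J: "J \<subseteq> ?Q" and card: "card (?P - I) = card (?Q - J)"
      and even: "even (card I)" by (auto simp: D_def)
    \<comment> \<open>\<open>p\<close> and \<open>q\<close> have the same parity, hence so do \<open>card I\<close> and \<open>card J\<close>\<close>
    have "card J + p = card I + q"
      using card card_compl[OF I] card_compl[OF J] by simp
    then have evenJ: "even (card J)" using even pq
      by (metis dvd_triv_left even_add)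
    have "A i j = b $$ (i, j)" if "i < p" "j < p" for i j
      using that pq by (simp add: \<open>b = _\<close> A f_def)
    then have "pf_on A I = pf_on (\<lambda>i j. b $$ (i, j)) I"
      using I by (intro pf_on_cong) (auto intro: finite_subset)
    then have "pf_on A I = pfaffian (submatrix b I I)"
      using pfaffian_submatrix[of b p I] I even by (simp add: \<open>b = _\<close>)
    moreover have "pf_on A (f ` J) = pf_on (\<lambda>i j. c $$ (i, j)) J"
    proof (rule pf_on_antimono)
      show "strict_antimono_on J f" using f_anti J by (rule monotone_on_subset)
      fix i j assume "i \<in> J" "j \<in> J"
      then have ij: "i < q" "j < q" "i < 2 * n" "j < 2 * n" using J pq by auto
      have "A (f i) (f j) = - X $$ (f j, i)"
        using ij X_anti[of "f i" j] by (simp add: A f_lt f_f)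
      then show "A (f i) (f j) = - c $$ (i, j)"
        using ij by (simp add: \<open>c = _\<close> f_def)
    qed (use J in \<open>auto intro: finite_subset\<close>)
    then have "pf_on A (f ` J) = pfaffian (submatrix c J J)"
      using pfaffian_submatrix[of c q J] J evenJ by (simp add: \<open>c = _\<close>)
    moreover have "shuffle_sgn ((?P - I) \<union> f ` (?Q - J)) (I \<union> f ` J)
        = sgn_split p (?P - I) I * sgn_split q (?Q - J) J"
      using I J even evenJ by (intro shuffle_sgn_blocks[OF _ _ _ _ f_anti f_ge]) auto
    ultimately show "shuffle_sgn ((?P - I) \<union> f ` (?Q - J)) (I \<union> f ` J) *
      (if card (?P - I) = card (?Q - J) then det (submatrix a (?P - I) (?Q - J)) else 0) *
      (pf_on A I * pf_on A (f ` J)) = t I J"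
      using card by (simp add: t_def)
  qed
  also have "\<dots> = (\<Sum>k = 0..r div 2. \<Sum>(I, J)\<in>{(I, J) \<in> D. card (?P - I) div 2 = k}. t I J)"
  proof -
    have fin: "finite D" using D_sub by (rule finite_subset) simp
    have img: "(\<lambda>(I, J). card (?P - I) div 2) ` D \<subseteq> {0..r div 2}"
    proof clarify
      fix I J assume "(I, J) \<in> D"
      then have "card (?P - I) \<le> p" "card (?P - I) \<le> q"
        using card_mono[of ?P "?P - I"] card_mono[of ?Q "?Q - J"] by (auto simp: D_def)
      then show "card (?P - I) div 2 \<in> {0..r div 2}"
        by (simp add: \<open>r = min p q\<close> div_le_mono)
    qed
    have "(\<Sum>k = 0..r div 2. \<Sum>IJ\<in>{IJ \<in> D. (\<lambda>(I, J). card (?P - I) div 2) IJ = k}. case_prod t IJ)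
        = (\<Sum>IJ\<in>D. case_prod t IJ)"
      using fin img by (intro sum.group) auto
    moreover have "{IJ \<in> D. (\<lambda>(I, J). card (?P - I) div 2) IJ = k} = {(I, J) \<in> D. card (?P - I) div 2 = k}" for k
      by auto
    ultimately show ?thesis by simp
  qed
  also have "\<dots> = (\<Sum>k = 0..r div 2. \<Sum>(I, J) | I \<subseteq> ?P \<and> J \<subseteq> ?Q \<and>
      card (?P - I) = 2 * k + \<epsilon> \<and> card (?Q - J) = 2 * k + \<epsilon>. t I J)"
  proof -
    \<comment> \<open>\<open>card I\<close> is even iff \<open>card (?P - I)\<close> has the parity \<open>\<epsilon>\<close> of \<open>p\<close>\<close>
    have "even (card I) \<and> card (?P - I) div 2 = k \<longleftrightarrow> card (?P - I) = 2 * k + \<epsilon>"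
      if "I \<subseteq> ?P" for I k
      using card_compl[OF that] by (auto simp: \<open>\<epsilon> = _\<close>) presburger+
    then have "{(I, J) \<in> D. card (?P - I) div 2 = k} = {(I, J). I \<subseteq> ?P \<and> J \<subseteq> ?Q \<and>
        card (?P - I) = 2 * k + \<epsilon> \<and> card (?Q - J) = 2 * k + \<epsilon>}" for k
      unfolding D_def by (safe; metis)
    then show ?thesis by simp
  qed
  finally show ?thesis unfolding t_def .
qed

end
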